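(* Let $0<p<\infty$. Let $\phi$ be an automorphism of the open unit disk $\mathbb{D}$ with a unique fixed point $\omega\in\mathbb{D}$, and let $\psi=B_\omega\circ\phi\circ B_\omega$. Let $S_{\mu_1},S_{\mu_2}$ be singular inner functions and, for $i=1,2$, let $\nu_i$ be the measure on the unit circle $\mathbb{T}$ given by $$\nu_i(E)=\int_{B_\omega(E)}\frac{1-|\omega|^2}{|t-\omega|^2}\,d\mu_i(t)$$ for each Borel subset $E$ of $\mathbb{T}$. Then the following are equivalent: (1) $C_\phi(S_{\mu_1}H^p)\subseteq S_{\mu_2}H^p$; (2) $C_\psi((S_{\mu_1}\circ B_\omega)H^p)\subseteq(S_{\mu_2}\circ B_\omega)H^p$; (3) $\nu_2(B_\omega(E))\le\nu_1(B_\omega(\phi(E)))$ for every Borel subset $E$ of $\mathbb{T}$.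
   Context: For $a\in\mathbb{D}$, $B_a(z)=\frac{a-z}{1-\overline{a}z}$, a disk automorphism with $B_a\circ B_a$ the identity; disk automorphisms extend to homeomorphisms of $\mathbb{T}$. For a finite positive Borel measure $\mu$ on $\mathbb{T}$ that is singular with respect to Lebesgue measure, $S_\mu(z)=\alpha\exp\left(-\int_{\mathbb{T}}\frac{t+z}{t-z}\,d\mu(t)\right)$ for some unimodular constant $\alpha$; such functions are the singular inner functions. $H^p$ is the Hardy space on $\mathbb{D}$, $\theta H^p=\{\theta f:f\in H^p\}$, and $C_\phi(f)=f\circ\phi$. *)

theory Defs
  imports "HOL-Complex_Analysis.Complex_Analysis"
begin

abbreviation unit_disk :: "complex set" where
  "unit_disk \<equiv> ball 0 1"

abbreviation unit_circle :: "complex set" where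
  "unit_circle \<equiv> sphere 0 1"

section \<open>Disk automorphisms\<close>

text \<open>Holomorphy of the inverse is automatic for a holomorphic bijection.\<close>

definition disk_automorphism :: "(complex \<Rightarrow> complex) \<Rightarrow> bool" where
  "disk_automorphism \<phi> \<longleftrightarrow>
     \<phi> holomorphic_on unit_disk \<and> bij_betw \<phi> unit_disk unit_disk"

text \<open>The values of \<open>\<phi>\<close> on the circle are not constrained by \<^const>\<open>disk_automorphism\<close>; the
  homeomorphism of the circle induced by \<open>\<phi>\<close> is obtained from the limits taken within the disk.\<close>

definition boundary_map :: "(complex \<Rightarrow> complex) \<Rightarrow> complex \<Rightarrow> complex" where
  "boundary_map \<phi> t = Lim (at t within unit_disk) \<phi>"

definition blaschke :: "complex \<Rightarrow> complex \<Rightarrow> complex" where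
  "blaschke a z = (a - z) / (1 - cnj a * z)"

section \<open>Measures on the unit circle and singular inner functions\<close>

definition circle_borel :: "complex measure" where
  "circle_borel = restrict_space borel unit_circle"

text \<open>Arc length, with total mass \<open>2 * pi\<close>; only its null sets are used below.\<close>

definition circle_lebesgue :: "complex measure" where
  "circle_lebesgue = distr (restrict_space lborel {0..<2 * pi}) circle_borel cis"

definition mutually_singular :: "'a measure \<Rightarrow> 'a measure \<Rightarrow> bool" where
  "mutually_singular M N \<longleftrightarrow>
     (\<exists>A \<in> sets M \<inter> sets N. emeasure M (space M - A) = 0 \<and> emeasure N A = 0)"

definition finite_singular_measure :: "complex measure \<Rightarrow> bool" where
  "finite_singular_measure \<mu> \<longleftrightarrow>
     sets \<mu> = sets circle_borel \<and> finite_measure \<mu> \<and> mutually_singular \<mu> circle_lebesgue"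

definition singular_inner :: "complex \<Rightarrow> complex measure \<Rightarrow> complex \<Rightarrow> complex" where
  "singular_inner \<alpha> \<mu> z = \<alpha> * exp (- (LINT t|\<mu>. (t + z) / (t - z)))"

text \<open>The set function below is countably additive, so that \<^const>\<open>measure_of\<close> does return
  a measure with these values: see \<open>emeasure_transported_measure\<close>.\<close>

definition transported_measure :: "complex \<Rightarrow> complex measure \<Rightarrow> complex measure" where
  "transported_measure \<omega> \<mu> = measure_of unit_circle (sets circle_borel)
     (\<lambda>E. \<integral>\<^sup>+t\<in>blaschke \<omega> ` E. ennreal ((1 - (cmod \<omega>)\<^sup>2) / (cmod (t - \<omega>))\<^sup>2) \<partial>\<mu>)"

section \<open>Hardy spaces\<close>

text \<open>Functions on the disk are represented by total functions that are \<^const>\<open>undefined\<close> off the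
  disk, so that equality of representatives is equality on the disk.\<close>

definition hardy_space :: "real \<Rightarrow> (complex \<Rightarrow> complex) set" where
  "hardy_space p = {f \<in> extensional unit_disk. f holomorphic_on unit_disk \<and>
     bdd_above ((\<lambda>r. 1 / (2 * pi) *
       integral {0..2 * pi} (\<lambda>s. cmod (f (of_real r * cis s)) powr p)) ` {0..<1})}"

definition times_space ::
    "(complex \<Rightarrow> complex) \<Rightarrow> (complex \<Rightarrow> complex) set \<Rightarrow> (complex \<Rightarrow> complex) set" where
  "times_space \<theta> X = (\<lambda>f. \<lambda>z\<in>unit_disk. \<theta> z * f z) ` X"

definition composition_operator ::
    "(complex \<Rightarrow> complex) \<Rightarrow> (complex \<Rightarrow> complex) \<Rightarrow> complex \<Rightarrow> complex" where
  "composition_operator \<phi> f = compose unit_disk f \<phi>"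

section \<open>The transported measure has the prescribed values\<close>

lemma blaschke_denom_nonzero:
  assumes "cmod a < 1" "cmod z \<le> 1"
  shows "1 - cnj a * z \<noteq> 0"
proof
  assume "1 - cnj a * z = 0"
  then have "cmod (cnj a * z) = 1" by (metis eq_iff_diff_eq_0 norm_one)
  moreover have "cmod (cnj a * z) \<le> cmod a * 1"
    using assms by (simp add: norm_mult mult_left_le)
  ultimately show False using assms by simp
qed

lemma blaschke_circle:
  assumes a: "cmod a < 1" and z: "cmod z = 1"
  shows "cmod (blaschke a z) = 1"
proof -
  have "z * cnj z = 1" using z by (simp add: complex_norm_square[symmetric])
  then have "1 - cnj a * z = z * cnj (z - a)" by (simp add: algebra_simps)
  then have "cmod (1 - cnj a * z) = cmod (a - z)"
    using z by (metis complex_mod_cnj mult_1 norm_minus_commute norm_mult)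
  moreover have "1 - cnj a * z \<noteq> 0" using blaschke_denom_nonzero a z by simp
  ultimately show ?thesis by (metis blaschke_def divide_self norm_divide norm_eq_zero)
qed

lemma blaschke_involution:
  assumes a: "cmod a < 1" and z: "cmod z \<le> 1"
  shows "blaschke a (blaschke a z) = z"
proof -
  have d: "1 - cnj a * z \<noteq> 0" using blaschke_denom_nonzero[OF a z] .
  have e: "1 - cnj a * a \<noteq> 0" using blaschke_denom_nonzero[OF a, of a] a by simp
  have n: "a - blaschke a z = z * (1 - cnj a * a) / (1 - cnj a * z)"
    using d by (simp add: blaschke_def field_simps)
  have m: "1 - cnj a * blaschke a z = (1 - cnj a * a) / (1 - cnj a * z)"
    using d by (simp add: blaschke_def field_simps)
  have "blaschke a (blaschke a z) = (a - blaschke a z) / (1 - cnj a * blaschke a z)"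
    by (simp add: blaschke_def)
  also have "\<dots> = z" using d e by (simp only: n m) simp
  finally show ?thesis .
qed

lemma space_circle_borel [simp]: "space circle_borel = unit_circle"
  by (simp add: circle_borel_def space_restrict_space)

lemma sets_circle_borel_subset: "E \<in> sets circle_borel \<Longrightarrow> E \<subseteq> unit_circle"
  using sets.sets_into_space by fastforce

lemma blaschke_measurable:
  assumes "cmod \<omega> < 1"
  shows "blaschke \<omega> \<in> measurable circle_borel circle_borel"
  unfolding circle_borel_def
proof (rule measurable_restrict_space3)
  show "blaschke \<omega> \<in> borel_measurable borel"
    unfolding blaschke_def[abs_def] by measurable
  show "blaschke \<omega> \<in> unit_circle \<rightarrow> unit_circle"
    using blaschke_circle[OF assms] by simp
qed

lemma blaschke_image_circle:
  assumes "cmod \<omega> < 1" "E \<subseteq> unit_circle"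
  shows "blaschke \<omega> ` E = blaschke \<omega> -` E \<inter> unit_circle"
proof (intro equalityI subsetI)
  fix x assume "x \<in> blaschke \<omega> ` E"
  then show "x \<in> blaschke \<omega> -` E \<inter> unit_circle"
    using assms blaschke_circle[OF assms(1)] blaschke_involution[OF assms(1)] by auto
next
  fix x assume "x \<in> blaschke \<omega> -` E \<inter> unit_circle"
  then show "x \<in> blaschke \<omega> ` E"
    using blaschke_involution[OF assms(1), of x] by (intro image_eqI[of _ _ "blaschke \<omega> x"]) auto
qed

lemma emeasure_transported_measure:
  assumes \<omega>: "\<omega> \<in> unit_disk" and \<mu>: "sets \<mu> = sets circle_borel" and E: "E \<in> sets circle_borel"
  shows "emeasure (transported_measure \<omega> \<mu>) E =
    (\<integral>\<^sup>+t\<in>blaschke \<omega> ` E. ennreal ((1 - (cmod \<omega>)\<^sup>2) / (cmod (t - \<omega>))\<^sup>2) \<partial>\<mu>)"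
proof -
  define k where "k = (\<lambda>t. ennreal ((1 - (cmod \<omega>)\<^sup>2) / (cmod (t - \<omega>))\<^sup>2))"
  define D where "D = distr (density \<mu> k) circle_borel (blaschke \<omega>)"
  have w: "cmod \<omega> < 1" using \<omega> by simp
  have sp: "space \<mu> = unit_circle" using sets_eq_imp_space_eq[OF \<mu>] by simp
  have "k \<in> borel_measurable (restrict_space borel unit_circle)"
    unfolding k_def by (rule measurable_restrict_space1) measurable
  then have k: "k \<in> borel_measurable \<mu>"
    using measurable_cong_sets[OF \<mu> refl, of borel] unfolding circle_borel_def by blast
  have B: "blaschke \<omega> \<in> measurable (density \<mu> k) circle_borel"
    using blaschke_measurable[OF w] measurable_cong_sets[of "density \<mu> k" circle_borel circle_borel]
    by (simp add: \<mu>)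
  have D: "emeasure D A = (\<integral>\<^sup>+t\<in>blaschke \<omega> ` A. k t \<partial>\<mu>)" if A: "A \<in> sets circle_borel" for A
  proof -
    have im: "blaschke \<omega> ` A = blaschke \<omega> -` A \<inter> unit_circle"
      using blaschke_image_circle[OF w sets_circle_borel_subset[OF A]] .
    then have "blaschke \<omega> ` A \<in> sets \<mu>"
      using measurable_sets[OF blaschke_measurable[OF w] A] by (simp add: \<mu>)
    then show ?thesis
      unfolding D_def using A im B k by (simp add: emeasure_distr emeasure_density sp)
  qed
  have "sigma_sets unit_circle (sets circle_borel) = sets circle_borel"
    using sets.sigma_sets_eq[of circle_borel] by simp
  then have "transported_measure \<omega> \<mu> = measure_of (space D) (sets D) (emeasure D)"
    unfolding transported_measure_def
    by (subst measure_of_eq[of _ _ _ "emeasure D"])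
       (use D sets_circle_borel_subset in \<open>auto simp: D_def k_def\<close>)
  then show ?thesis using D[OF E] by (simp add: measure_of_of_measure k_def)
qed

end

theory Submission
  imports Defs
begin

text \<open>
  Write \<open>P[\<sigma>](z)\<close> for the Poisson integral of a finite measure \<open>\<sigma>\<close> on the circle.  The modulus of a
  singular inner function is \<open>exp (- P[\<mu>])\<close>, and everything below is a comparison of such exponents.

  Since \<open>\<phi>\<close> fixes \<open>\<omega>\<close>, the map \<open>\<psi>\<close> is an automorphism fixing \<open>0\<close>, hence a rotation \<open>z \<mapsto> c * z\<close> by
  the Schwarz lemma applied to it and to its inverse.  Conformal invariance of the Poisson kernel
  (\<open>poisson_kernel_blaschke\<close>) gives \<open>P[\<mu>\<^sub>i](B_\<omega> z) = P[\<nu>\<^sub>i](z)\<close>, and so the moduli of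
  \<open>S\<^sub>1 \<circ> B_\<omega> \<circ> \<psi>\<close> and \<open>S\<^sub>2 \<circ> B_\<omega>\<close> are \<open>exp (- P[\<sigma>])\<close> and \<open>exp (- P[\<nu>\<^sub>2])\<close>, where
  \<open>\<sigma>(E) = \<nu>\<^sub>1(c E)\<close>.  As \<open>B_\<omega> \<circ> \<phi> = \<psi> \<circ> B_\<omega>\<close> also on the circle, the inequality
  between the measures in the third condition says that \<open>\<nu>\<^sub>2 \<le> \<sigma>\<close>.

  The first two conditions are conjugate to each other by composition with \<open>B_\<omega>\<close>, because such
  compositions map Hardy spaces into themselves.  This is Littlewood's subordination principle
  (\<open>hardy_space_compose\<close>): \<open>cmod f powr p\<close> is dominated by the Poisson integral of its boundary
  values, for every positive \<open>p\<close>, and Poisson kernels composed with a holomorphic self-map of the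
  disk are real parts of holomorphic functions, so that their circle means are known.

  If \<open>\<nu>\<^sub>2 \<le> \<sigma>\<close>, then the quotient \<open>(S\<^sub>1 \<circ> B_\<omega> \<circ> \<psi>) / (S\<^sub>2 \<circ> B_\<omega>)\<close> is bounded by one, and
  multiplication by it preserves the Hardy space; this gives the inclusion.

  Conversely, the inclusion applied to the constant function one yields \<open>g\<close> in the Hardy space with
  \<open>S\<^sub>1 \<circ> \<phi> = S\<^sub>2 * g\<close>, so that \<open>cmod g = exp (P[\<mu>\<^sub>2] - P[\<tau>])\<close> for the measure \<open>\<tau>\<close> obtained from \<open>\<sigma>\<close> by
  transport.  The bound on the means of \<open>cmod g powr p\<close> makes the positive part of
  \<open>P[\<mu>\<^sub>2] - P[\<tau>]\<close> uniformly integrable over the circles of radius less than one, and therefore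
  \<open>\<mu>\<^sub>2 - \<tau>\<close> is dominated by an absolutely continuous measure.  As \<open>\<mu>\<^sub>2\<close> lives on a Lebesgue
  null set, \<open>\<mu>\<^sub>2 \<le> \<tau>\<close> (\<open>singular_measure_le\<close>).  Transporting this inequality by \<open>B_\<omega>\<close>, and
  using that transport is an involution, gives \<open>\<nu>\<^sub>2 \<le> \<sigma>\<close>.  The comparison is first made
  between \<open>\<mu>\<^sub>2\<close> and \<open>\<tau>\<close> because \<open>\<mu>\<^sub>2\<close> is the measure that is given as singular.
\<close>

section \<open>The Poisson kernel and means over the circle\<close>

definition poisson_kernel :: "complex \<Rightarrow> complex \<Rightarrow> real" where
  "poisson_kernel t z = (1 - (cmod z)\<^sup>2) / (cmod (t - z))\<^sup>2"

definition circle_mean :: "(complex \<Rightarrow> real) \<Rightarrow> real" where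
  "circle_mean f = 1 / (2 * pi) * integral {0..2 * pi} (\<lambda>s. f (cis s))"

lemma circle_disk_distinct: "cmod t = 1 \<Longrightarrow> cmod z < 1 \<Longrightarrow> t - z \<noteq> 0"
  by auto

lemma poisson_kernel_nonneg: "cmod z < 1 \<Longrightarrow> 0 \<le> poisson_kernel t z"
  by (simp add: poisson_kernel_def abs_square_le_1)

lemma poisson_kernel_zero [simp]: "cmod t = 1 \<Longrightarrow> poisson_kernel t 0 = 1"
  by (simp add: poisson_kernel_def)

text \<open>This exhibits the Poisson kernel as a harmonic function of \<open>z\<close>, with an explicit holomorphic function behind it.\<close>

lemma Re_herglotz_kernel:
  assumes "cmod t = 1" "cmod z < 1"
  shows "Re ((t + z) / (t - z)) = poisson_kernel t z"
proof -
  have "Re ((t + z) / (t - z)) = Re ((t + z) * cnj (t - z)) / (cmod (t - z))\<^sup>2"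
    by (subst complex_div_cnj) (simp only: Re_divide_of_real of_real_power[symmetric])
  also have "Re ((t + z) * cnj (t - z)) = (cmod t)\<^sup>2 - (cmod z)\<^sup>2"
    unfolding cmod_power2 by (simp add: algebra_simps power2_eq_square)
  finally show ?thesis using assms by (simp add: poisson_kernel_def)
qed

lemma cnj_unit_mult: "cmod t = 1 \<Longrightarrow> t * cnj t = 1"
  by (simp add: complex_norm_square[symmetric])

lemma continuous_on_poisson_kernel_circle:
  "cmod z < 1 \<Longrightarrow> continuous_on unit_circle (\<lambda>t. poisson_kernel t z)"
  unfolding poisson_kernel_def by (intro continuous_intros) auto

lemma continuous_on_circle_cis:
  assumes "continuous_on unit_circle f"
  shows "continuous_on A (\<lambda>s. f (cis s))"
  by (rule continuous_on_compose2[OF assms]) (auto intro: continuous_intros)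

lemma circle_mean_mono:
  assumes "continuous_on unit_circle f" "continuous_on unit_circle g"
    and "\<And>t. cmod t = 1 \<Longrightarrow> f t \<le> g t"
  shows "circle_mean f \<le> circle_mean g"
  unfolding circle_mean_def using assms
  by (intro mult_left_mono integral_le integrable_continuous_real continuous_on_circle_cis) auto

lemma circle_mean_add:
  assumes "continuous_on unit_circle f" "continuous_on unit_circle g"
  shows "circle_mean (\<lambda>t. f t + g t) = circle_mean f + circle_mean g"
  unfolding circle_mean_def using assms
  by (subst integral_add) (auto intro!: integrable_continuous_real continuous_on_circle_cis simp: algebra_simps)

lemma circle_mean_cmult: "circle_mean (\<lambda>t. c * f t) = c * circle_mean f"
  by (simp add: circle_mean_def)

lemma circle_mean_const [simp]: "circle_mean (\<lambda>t. c) = c"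
  by (simp add: circle_mean_def)

lemma circle_mean_cong:
  assumes "\<And>t. cmod t = 1 \<Longrightarrow> f t = g t"
  shows "circle_mean f = circle_mean g"
  unfolding circle_mean_def using assms by (intro arg_cong2[where f="(*)"] integral_cong) auto

text \<open>This is the Cauchy formula for \<open>\<zeta> \<mapsto> k \<zeta> * (1 - (cmod w)\<^sup>2) / (1 - cnj w * \<zeta>)\<close>, a function that is still
  holomorphic on the closed disk and agrees with \<open>k\<close> at \<open>w\<close>.  On the circle
  \<open>1 - cnj w * \<zeta> = \<zeta> * cnj (\<zeta> - w)\<close>, which turns the Cauchy kernel into the Poisson kernel.\<close>

lemma poisson_integral_formula:
  fixes k :: "complex \<Rightarrow> complex"
  assumes k: "k holomorphic_on cball 0 1" and w: "cmod w < 1"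
  shows "((\<lambda>s. k (cis s) * of_real (poisson_kernel (cis s) w)) has_integral 2 * pi * k w) {0..2 * pi}"
proof -
  have sq: "(complex_of_real (cmod z))\<^sup>2 = z * cnj z" for z
    using complex_norm_square[of z] by simp
  define F where "F = (\<lambda>z. k z * (1 - (cmod w)\<^sup>2) / (1 - cnj w * z))"
  have nz: "1 - cnj w * z \<noteq> 0" if "cmod z \<le> 1" for z
    using blaschke_denom_nonzero w that by blast
  have "F holomorphic_on cball 0 1" unfolding F_def
    by (intro holomorphic_intros k) (use nz in auto)
  from Cauchy_integral_circlepath_simple[OF this, of w] w
  have "((\<lambda>u. F u / (u - w)) has_contour_integral 2 * of_real pi * \<i> * F w) (part_circlepath 0 1 0 (2*pi))"
    by (simp add: circlepath_def)
  then have "((\<lambda>s. F (cis s) / (cis s - w) * \<i> * cis s) has_integral 2 * of_real pi * \<i> * F w) {0..2*pi}"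
    by (subst (asm) has_contour_integral_part_circlepath_iff) auto
  then have hi: "((\<lambda>s. (-\<i>) * (F (cis s) / (cis s - w) * \<i> * cis s)) has_integral
      (-\<i>) * (2 * of_real pi * \<i> * F w)) {0..2*pi}"
    by (rule has_integral_mult_right)
  have eqv: "(-\<i>) * (2 * of_real pi * \<i> * F w) = 2 * pi * k w"
    using nz[of w] w by (simp add: F_def sq field_simps)
  have pt: "(-\<i>) * (F u / (u - w) * \<i> * u) = k u * of_real (poisson_kernel u w)" if u: "cmod u = 1" for u
  proof -
    have e: "1 - cnj w * u = u * cnj (u - w)"
      using cnj_unit_mult[OF u] by (simp add: algebra_simps)
    have "u \<noteq> 0" "u - w \<noteq> 0" using u w by auto
    then show ?thesis
      unfolding F_def e poisson_kernel_def
      by (simp add: sq field_simps del: complex_cnj_diff)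
  qed
  have eqf: "(\<lambda>s. (-\<i>) * (F (cis s) / (cis s - w) * \<i> * cis s)) =
      (\<lambda>s. k (cis s) * of_real (poisson_kernel (cis s) w))"
    by (rule ext, rule pt) simp
  show ?thesis using hi unfolding eqf eqv .
qed

lemma circle_mean_poisson_holomorphic:
  assumes k: "k holomorphic_on cball 0 1" and w: "cmod w < 1"
  shows "circle_mean (\<lambda>t. Re (k t) * poisson_kernel t w) = Re (k w)"
proof -
  from has_integral_Re[OF poisson_integral_formula[OF assms]]
  show ?thesis unfolding circle_mean_def
    by (subst integral_unique) auto
qed

lemma circle_mean_Re_holomorphic:
  assumes k: "k holomorphic_on cball 0 1"
  shows "circle_mean (\<lambda>t. Re (k t)) = Re (k 0)"
proof -
  have "circle_mean (\<lambda>t. Re (k t)) = circle_mean (\<lambda>t. Re (k t) * poisson_kernel t 0)"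
    by (rule circle_mean_cong) simp
  then show ?thesis using circle_mean_poisson_holomorphic[OF k, of 0] by simp
qed

lemma circle_mean_poisson_kernel:
  assumes "cmod w < 1"
  shows "circle_mean (\<lambda>t. poisson_kernel t w) = 1"
  using circle_mean_poisson_holomorphic[of "\<lambda>_. 1", OF _ assms] by simp

lemma norm_poisson_le_circle_mean:
  assumes k: "k holomorphic_on cball 0 1" and w: "cmod w < 1"
  shows "cmod (k w) \<le> circle_mean (\<lambda>t. cmod (k t) * poisson_kernel t w)"
proof -
  have kc: "continuous_on unit_circle k"
    using holomorphic_on_imp_continuous_on[OF k] by (rule continuous_on_subset) auto
  have "norm (integral {0..2*pi} (\<lambda>s. k (cis s) * of_real (poisson_kernel (cis s) w)))
      \<le> integral {0..2*pi} (\<lambda>s. cmod (k (cis s)) * poisson_kernel (cis s) w)"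
  proof (rule integral_norm_bound_integral)
    show "(\<lambda>s. cmod (k (cis s)) * poisson_kernel (cis s) w) integrable_on {0..2*pi}"
      by (intro integrable_continuous_real continuous_on_circle_cis[of "\<lambda>t. cmod (k t) * poisson_kernel t w"]
          continuous_intros continuous_on_poisson_kernel_circle w kc)
  qed (use has_integral_integrable[OF poisson_integral_formula[OF assms]] in
       \<open>auto simp: norm_mult poisson_kernel_nonneg[OF w]\<close>)
  then show ?thesis
    using integral_unique[OF poisson_integral_formula[OF assms]]
    by (simp add: circle_mean_def norm_mult field_simps)
qed

section \<open>Domination of powers of holomorphic functions by Poisson integrals\<close>

text \<open>The identity behind all metric properties of \<open>blaschke a\<close>: dividing by
  \<open>(cmod (1 - cnj a * z))\<^sup>2\<close> makes the left-hand side \<open>1 - (cmod (blaschke a z))\<^sup>2\<close>.\<close>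

lemma norm_blaschke_parts:
  "(cmod (1 - cnj a * z))\<^sup>2 - (cmod (a - z))\<^sup>2 = (1 - (cmod a)\<^sup>2) * (1 - (cmod z)\<^sup>2)"
  unfolding cmod_power2 by (simp add: algebra_simps power2_eq_square)

text \<open>Dividing \<open>g\<close> by the finite Blaschke product with the same zeros in the disk does not change the
  modulus on the circle and does not decrease it inside.  The induction is on the number of distinct
  zeros, each of which is removed with its full multiplicity.\<close>

lemma divide_out_disk_zeros:
  assumes S: "open S" "connected S" "cball 0 1 \<subseteq> S"
    and "g holomorphic_on S" "\<And>t. cmod t = 1 \<Longrightarrow> g t \<noteq> 0"
  shows "\<exists>h. h holomorphic_on S \<and> (\<forall>z. cmod z \<le> 1 \<longrightarrow> h z \<noteq> 0 \<and> cmod (g z) \<le> cmod (h z)) \<and>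
    (\<forall>t. cmod t = 1 \<longrightarrow> cmod (h t) = cmod (g t))"
  using assms(4,5)
proof (induction "card {z \<in> cball 0 1. g z = 0}" arbitrary: g rule: less_induct)
  case less
  show ?case
  proof (cases "\<exists>a. cmod a \<le> 1 \<and> g a = 0")
    case False
    then show ?thesis using less.prems by blast
  next
    case True
    then obtain a where a1: "cmod a \<le> 1" and ga: "g a = 0" by blast
    have a: "cmod a < 1" using a1 ga less.prems(2)[of a] by fastforce
    have aS: "a \<in> S" and "1 \<in> S" using S(3) a1 by auto
    have "\<not> g constant_on S"
      using less.prems(2)[of 1] ga aS \<open>1 \<in> S\<close> unfolding constant_on_def by force
    from holomorphic_factor_zero_nonconstant[OF less.prems(1) S(1,2) aS ga this]
    obtain k r n where n: "0 < n" and r: "0 < r" "ball a r \<subseteq> S"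
      and k: "k holomorphic_on ball a r" and gk: "\<And>w. w \<in> ball a r \<Longrightarrow> g w = (w - a) ^ n * k w"
      and knz: "\<And>w. w \<in> ball a r \<Longrightarrow> k w \<noteq> 0" by metis
    have fin: "finite {z \<in> cball 0 1. g z = 0}"
      using holomorphic_compact_finite_zeros[OF less.prems(1) S(1,2) compact_cball S(3)] \<open>\<not> g constant_on S\<close> .
    \<comment> \<open>The factorization of \<open>g\<close> at \<open>a\<close> is local; away from \<open>a\<close> the cofactor is the quotient.\<close>
    define q where "q = (\<lambda>z. if z = a then k a else g z / (z - a) ^ n)"
    have qb: "q z = k z" if "z \<in> ball a r" for z
      using gk[OF that] by (auto simp: q_def)
    have gq: "g z = (z - a) ^ n * q z" for z
      using ga n by (auto simp: q_def)
    have "q holomorphic_on ball a r"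
      using k by (rule holomorphic_transform) (simp add: qb)
    moreover have "(\<lambda>z. g z / (z - a) ^ n) holomorphic_on S - {a}"
      by (intro holomorphic_intros holomorphic_on_subset[OF less.prems(1)]) auto
    then have "q holomorphic_on S - {a}"
      by (rule holomorphic_transform) (auto simp: q_def)
    moreover have "S = ball a r \<union> (S - {a})" using r by auto
    ultimately have q: "q holomorphic_on S"
      using holomorphic_on_Un[of q "ball a r" "S - {a}"] S(1) by (simp add: open_delete)
    define h where "h = (\<lambda>z. (1 - cnj a * z) ^ n * q z)"
    have nz: "1 - cnj a * z \<noteq> 0" if "cmod z \<le> 1" for z
      using blaschke_denom_nonzero[OF a that] .
    have h: "h holomorphic_on S" unfolding h_def by (intro holomorphic_intros q)
    have zeros: "h z = 0 \<longleftrightarrow> g z = 0 \<and> z \<noteq> a" if "cmod z \<le> 1" for z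
      using nz[OF that] knz[of a] r by (auto simp: h_def q_def)
    have le: "cmod (g z) \<le> cmod (h z)" if z: "cmod z \<le> 1" for z
    proof -
      have "0 \<le> (1 - (cmod a)\<^sup>2) * (1 - (cmod z)\<^sup>2)"
        using a z by (simp add: abs_square_le_1)
      then have "(cmod (z - a))\<^sup>2 \<le> (cmod (1 - cnj a * z))\<^sup>2"
        unfolding norm_minus_commute[of z a] using norm_blaschke_parts[of a z] by linarith
      then have "cmod (z - a) \<le> cmod (1 - cnj a * z)"
        by (rule power2_le_imp_le) simp
      then show ?thesis
        unfolding gq[of z] h_def norm_mult norm_power by (intro mult_right_mono power_mono) auto
    qed
    have eq: "cmod (h t) = cmod (g t)" if t: "cmod t = 1" for t
    proof -
      have "(cmod (t - a))\<^sup>2 = (cmod (1 - cnj a * t))\<^sup>2"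
        using norm_blaschke_parts[of a t] norm_minus_commute[of t a] t by simp
      then have "cmod (t - a) = cmod (1 - cnj a * t)" by (rule power2_eq_imp_eq) simp_all
      then show ?thesis unfolding gq[of t] h_def norm_mult norm_power by simp
    qed
    have "card {z \<in> cball 0 1. h z = 0} < card {z \<in> cball 0 1. g z = 0}"
      using zeros a1 ga by (intro psubset_card_mono fin) auto
    moreover have "h t \<noteq> 0" if "cmod t = 1" for t using zeros[of t] less.prems(2) that by simp
    ultimately obtain h' where "h' holomorphic_on S"
      "\<forall>z. cmod z \<le> 1 \<longrightarrow> h' z \<noteq> 0 \<and> cmod (h z) \<le> cmod (h' z)"
      "\<forall>t. cmod t = 1 \<longrightarrow> cmod (h' t) = cmod (h t)"
      using less.hyps[of h] h by blast
    then show ?thesis using le eq by (metis order_trans)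
  qed
qed

text \<open>The subharmonicity of \<open>cmod g powr p\<close>, for all positive \<open>p\<close>.  When \<open>g\<close> has no zeros,
  \<open>cmod g powr p\<close> is the modulus of a holomorphic branch of the \<open>p\<close>-th power, to which the Poisson
  formula applies; in general \<open>g\<close> is first replaced by a zero-free majorant with the same boundary
  modulus.\<close>

lemma powr_norm_le_poisson_mean:
  assumes S: "open S" "connected S" "cball 0 1 \<subseteq> S" and g: "g holomorphic_on S"
    and nz: "\<And>t. cmod t = 1 \<Longrightarrow> g t \<noteq> 0" and p: "0 < p" and w: "cmod w < 1"
  shows "cmod (g w) powr p \<le> circle_mean (\<lambda>t. cmod (g t) powr p * poisson_kernel t w)"
proof -
  obtain h where h: "h holomorphic_on S" and hnz: "\<And>z. cmod z \<le> 1 \<Longrightarrow> h z \<noteq> 0"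
    and le: "\<And>z. cmod z \<le> 1 \<Longrightarrow> cmod (g z) \<le> cmod (h z)"
    and eq: "\<And>t. cmod t = 1 \<Longrightarrow> cmod (h t) = cmod (g t)"
    using divide_out_disk_zeros[OF S g nz] by metis
  have "h holomorphic_on cball 0 1" using h S(3) by (rule holomorphic_on_subset)
  moreover have "contractible (cball (0::complex) 1)" by (intro convex_imp_contractible) auto
  ultimately obtain l where l: "l holomorphic_on cball 0 1"
    and hl: "\<And>z. z \<in> cball 0 1 \<Longrightarrow> h z = exp (l z)"
    using contractible_imp_holomorphic_log[of h "cball 0 1"] hnz by auto
  have norm: "cmod (exp (of_real p * l z)) = cmod (h z) powr p" if "cmod z \<le> 1" for z
    using hl[of z] that by (simp add: powr_def mult.commute)
  have "(\<lambda>z. exp (of_real p * l z)) holomorphic_on cball 0 1" by (intro holomorphic_intros l)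
  from norm_poisson_le_circle_mean[OF this w]
  have "cmod (h w) powr p \<le> circle_mean (\<lambda>t. cmod (exp (of_real p * l t)) * poisson_kernel t w)"
    using w by (subst (asm) norm) auto
  also have "\<dots> = circle_mean (\<lambda>t. cmod (g t) powr p * poisson_kernel t w)"
    by (rule circle_mean_cong) (simp only: norm eq order_refl)
  finally show ?thesis
    using le[of w] w p powr_mono2[of p "cmod (g w)" "cmod (h w)"] by auto
qed

section \<open>Boundedness of composition operators on Hardy spaces\<close>

lemma continuous_on_norm_powr:
  fixes f :: "'a::topological_space \<Rightarrow> complex"
  assumes "continuous_on S f" "0 < p"
  shows "continuous_on S (\<lambda>x. cmod (f x) powr p)"
  using assms by (intro continuous_on_powr' continuous_on_norm continuous_on_const) auto

lemma poisson_kernel_le: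
  assumes "cmod t = 1" "cmod w < 1"
  shows "poisson_kernel t w \<le> (1 + cmod w) / (1 - cmod w)"
proof -
  have "1 - cmod w \<le> cmod (t - w)" using assms norm_triangle_ineq2[of t w] by simp
  then have "(1 - cmod w)\<^sup>2 \<le> (cmod (t - w))\<^sup>2" using assms by (intro power_mono) auto
  then have "poisson_kernel t w \<le> (1 - (cmod w)\<^sup>2) / (1 - cmod w)\<^sup>2"
    unfolding poisson_kernel_def using assms circle_disk_distinct[OF assms]
    by (intro divide_left_mono mult_pos_pos) (auto simp: abs_square_le_1)
  also have "\<dots> = (1 + cmod w) / (1 - cmod w)"
    using assms square_diff_square_factored[of 1 "cmod w"] by (simp add: power2_eq_square)
  finally show ?thesis .
qed

text \<open>The mean value property, as \<open>poisson_kernel t \<circ> \<phi>\<close> is the real part of the holomorphic function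
  \<open>(t + \<phi>) / (t - \<phi>)\<close>.\<close>

lemma circle_mean_poisson_compose:
  assumes \<phi>: "\<phi> holomorphic_on unit_disk" "\<phi> \<in> unit_disk \<rightarrow> unit_disk"
    and \<rho>: "0 \<le> \<rho>" "\<rho> < 1" and t: "cmod t = 1"
  shows "circle_mean (\<lambda>\<zeta>. poisson_kernel t (\<phi> (of_real \<rho> * \<zeta>))) = poisson_kernel t (\<phi> 0)"
proof -
  define k where "k = (\<lambda>\<zeta>. (t + \<phi> (of_real \<rho> * \<zeta>)) / (t - \<phi> (of_real \<rho> * \<zeta>)))"
  have in_disk: "cmod (of_real \<rho> * \<zeta>) < 1" if "cmod \<zeta> \<le> 1" for \<zeta>
  proof -
    have "cmod (of_real \<rho> * \<zeta>) \<le> \<rho> * 1"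
      unfolding norm_mult using \<rho> that by (intro mult_mono) auto
    then show ?thesis using \<rho> by simp
  qed
  have \<phi>1: "cmod (\<phi> (of_real \<rho> * \<zeta>)) < 1" if "cmod \<zeta> \<le> 1" for \<zeta>
    using \<phi>(2) in_disk[OF that] by (auto simp: Pi_iff)
  have "(\<lambda>\<zeta>. \<phi> (of_real \<rho> * \<zeta>)) holomorphic_on cball 0 1"
    by (rule holomorphic_on_compose_gen[OF _ \<phi>(1), unfolded o_def])
       (auto intro!: holomorphic_intros simp: in_disk)
  then have "k holomorphic_on cball 0 1"
    unfolding k_def using circle_disk_distinct[OF t \<phi>1] by (intro holomorphic_intros) auto
  from circle_mean_Re_holomorphic[OF this] show ?thesis
    using Re_herglotz_kernel[OF t \<phi>1] \<phi>1[of 0] by (simp add: Re_herglotz_kernel[OF t] k_def cong: circle_mean_cong)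
qed

lemma continuous_on_cis_pair:
  assumes "continuous_on (X \<times> unit_circle) (\<lambda>(x, t). F x t)"
  shows "continuous_on (X \<times> A) (\<lambda>(x, s). F x (cis s))"
  unfolding case_prod_unfold
  by (rule continuous_on_compose2[OF assms, of _ "\<lambda>x. (fst x, cis (snd x))", unfolded case_prod_unfold fst_conv snd_conv])
     (auto intro!: continuous_intros)

lemma continuous_on_circle_mean:
  fixes F :: "'a::topological_space \<Rightarrow> complex \<Rightarrow> real"
  assumes "continuous_on (X \<times> unit_circle) (\<lambda>(x, t). F x t)"
  shows "continuous_on X (\<lambda>x. circle_mean (F x))"
  unfolding circle_mean_def
  using integral_continuous_on_param[of X 0 "2 * pi" "\<lambda>x s. F x (cis s)"] continuous_on_cis_pair[OF assms]
  by (intro continuous_intros) auto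

lemma circle_mean_swap:
  fixes F :: "complex \<Rightarrow> complex \<Rightarrow> real"
  assumes "continuous_on (unit_circle \<times> unit_circle) (\<lambda>(x, y). F x y)"
  shows "circle_mean (\<lambda>x. circle_mean (F x)) = circle_mean (\<lambda>y. circle_mean (\<lambda>x. F x y))"
proof -
  have "continuous_on ({0..2*pi} \<times> {0..2*pi}) (\<lambda>x. F (cis (fst x)) (cis (snd x)))"
    by (rule continuous_on_compose2[OF assms, of _ "\<lambda>x. (cis (fst x), cis (snd x))", unfolded case_prod_unfold fst_conv snd_conv])
       (auto intro!: continuous_intros)
  then show ?thesis
    using integral_swap_continuous[of 0 0 "2*pi" "2*pi" "\<lambda>x y. F (cis x) (cis y)"]
    by (simp add: circle_mean_def case_prod_unfold cbox_Pair_eq)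
qed

text \<open>Littlewood's inequality for the dilation \<open>z \<mapsto> f (r * z)\<close>, which is holomorphic across the circle.  Its
  \<open>p\<close>-th power modulus at \<open>\<phi> (\<rho> * \<zeta>)\<close> is dominated by a Poisson integral over \<open>t\<close>, and after exchanging the means
  over \<open>\<zeta>\<close> and \<open>t\<close> the inner one is \<open>poisson_kernel t (\<phi> 0)\<close>, whatever \<open>\<rho>\<close>.\<close>

lemma hardy_space_compose_dilated:
  assumes p: "0 < p" and f: "f holomorphic_on unit_disk"
    and \<phi>: "\<phi> holomorphic_on unit_disk" "\<phi> \<in> unit_disk \<rightarrow> unit_disk"
    and r: "0 < r" "r < 1" and nz: "\<And>z. cmod z = r \<Longrightarrow> f z \<noteq> 0"
    and \<rho>: "0 \<le> \<rho>" "\<rho> < 1"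
  shows "circle_mean (\<lambda>\<zeta>. cmod (f (of_real r * \<phi> (of_real \<rho> * \<zeta>))) powr p)
    \<le> (1 + cmod (\<phi> 0)) / (1 - cmod (\<phi> 0)) * circle_mean (\<lambda>t. cmod (f (of_real r * t)) powr p)"
proof -
  define g where "g = (\<lambda>z. f (of_real r * z))"
  let ?u = "\<lambda>\<zeta>. \<phi> (of_real \<rho> * \<zeta>)"
  have g: "g holomorphic_on ball 0 (1 / r)"
    unfolding g_def using r
    by (intro holomorphic_on_compose_gen[OF _ f, unfolded o_def])
       (auto intro!: holomorphic_intros simp: norm_mult field_simps)
  have gc: "continuous_on (ball 0 (1 / r)) g" using g by (rule holomorphic_on_imp_continuous_on)
  have "1 < 1 / r" using r by simp
  then have sub: "cball 0 1 \<subseteq> ball (0::complex) (1 / r)" by auto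
  have u1: "cmod (?u \<zeta>) < 1" if "cmod \<zeta> = 1" for \<zeta>
    using \<phi>(2) \<rho> that by (auto simp: Pi_iff norm_mult)
  have \<phi>0: "cmod (\<phi> 0) < 1" using \<phi>(2) by (auto simp: Pi_iff)
  have uc: "continuous_on unit_circle ?u"
    by (rule continuous_on_compose2[OF holomorphic_on_imp_continuous_on[OF \<phi>(1)]])
       (use \<rho> in \<open>auto intro!: continuous_intros simp: norm_mult\<close>)
  have gpc: "continuous_on unit_circle (\<lambda>t. cmod (g t) powr p)"
    using p sub by (intro continuous_on_norm_powr continuous_on_subset[OF gc]) auto
  have guc: "continuous_on unit_circle (\<lambda>\<zeta>. cmod (g (?u \<zeta>)) powr p)"
    using p sub u1
    by (intro continuous_on_norm_powr continuous_on_compose2[OF gc uc]) fastforce+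
  have joint: "continuous_on (unit_circle \<times> unit_circle) (\<lambda>(\<zeta>, t). cmod (g t) powr p * poisson_kernel t (?u \<zeta>))"
  proof -
    have gp: "continuous_on (unit_circle \<times> unit_circle) (\<lambda>x. cmod (g (snd x)) powr p)"
      by (rule continuous_on_compose2[OF gpc]) (auto intro: continuous_intros)
    have "continuous_on (unit_circle \<times> unit_circle) (\<lambda>x. ?u (fst x))"
      by (rule continuous_on_compose2[OF uc]) (auto intro: continuous_intros)
    moreover have "snd x - ?u (fst x) \<noteq> 0" if "x \<in> unit_circle \<times> unit_circle" for x
      using that circle_disk_distinct[of "snd x" "?u (fst x)"] u1 by auto
    ultimately have "continuous_on (unit_circle \<times> unit_circle) (\<lambda>x. poisson_kernel (snd x) (?u (fst x)))"
      unfolding poisson_kernel_def by (intro continuous_intros) auto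
    with gp show ?thesis
      unfolding case_prod_unfold by (rule continuous_on_mult)
  qed
  then have joint': "continuous_on (unit_circle \<times> unit_circle) (\<lambda>(t, \<zeta>). cmod (g t) powr p * poisson_kernel t (?u \<zeta>))"
    using continuous_on_swap_args by blast
  have "circle_mean (\<lambda>\<zeta>. cmod (g (?u \<zeta>)) powr p)
      \<le> circle_mean (\<lambda>\<zeta>. circle_mean (\<lambda>t. cmod (g t) powr p * poisson_kernel t (?u \<zeta>)))"
  proof (rule circle_mean_mono[OF guc continuous_on_circle_mean[OF joint]])
    fix \<zeta> :: complex assume "cmod \<zeta> = 1"
    then show "cmod (g (?u \<zeta>)) powr p \<le> circle_mean (\<lambda>t. cmod (g t) powr p * poisson_kernel t (?u \<zeta>))"
      using r by (intro powr_norm_le_poisson_mean[OF _ _ sub g _ p u1]) (auto simp: g_def norm_mult nz)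
  qed
  also have "\<dots> = circle_mean (\<lambda>t. circle_mean (\<lambda>\<zeta>. cmod (g t) powr p * poisson_kernel t (?u \<zeta>)))"
    by (rule circle_mean_swap[OF joint])
  also have "\<dots> = circle_mean (\<lambda>t. cmod (g t) powr p * poisson_kernel t (\<phi> 0))"
    unfolding circle_mean_cmult by (rule circle_mean_cong) (simp add: circle_mean_poisson_compose[OF \<phi> \<rho>])
  also have "\<dots> \<le> circle_mean (\<lambda>t. (1 + cmod (\<phi> 0)) / (1 - cmod (\<phi> 0)) * cmod (g t) powr p)"
  proof (rule circle_mean_mono)
    fix t :: complex assume "cmod t = 1"
    then show "cmod (g t) powr p * poisson_kernel t (\<phi> 0)
        \<le> (1 + cmod (\<phi> 0)) / (1 - cmod (\<phi> 0)) * cmod (g t) powr p"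
      using mult_right_mono[OF poisson_kernel_le[OF _ \<phi>0], of t "cmod (g t) powr p"]
      by (simp only: mult.commute powr_ge_zero)
  qed (intro continuous_intros gpc continuous_on_poisson_kernel_circle \<phi>0)+
  finally show ?thesis by (simp only: circle_mean_cmult g_def)
qed

lemma mem_hardy_space_iff:
  "f \<in> hardy_space p \<longleftrightarrow> f \<in> extensional unit_disk \<and> f holomorphic_on unit_disk \<and>
    (\<exists>M. \<forall>r. 0 \<le> r \<and> r < 1 \<longrightarrow> circle_mean (\<lambda>t. cmod (f (of_real r * t)) powr p) \<le> M)"
  unfolding hardy_space_def circle_mean_def bdd_above_def by simp (simp add: Ball_def)

lemma hardy_spaceI:
  assumes "f \<in> extensional unit_disk" "f holomorphic_on unit_disk"
    and "\<And>r. 0 \<le> r \<Longrightarrow> r < 1 \<Longrightarrow> circle_mean (\<lambda>t. cmod (f (of_real r * t)) powr p) \<le> M"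
  shows "f \<in> hardy_space p"
  using assms unfolding mem_hardy_space_iff by blast

lemma hardy_spaceE:
  assumes "f \<in> hardy_space p"
  obtains M where "f \<in> extensional unit_disk" "f holomorphic_on unit_disk"
    and "\<And>r. 0 \<le> r \<Longrightarrow> r < 1 \<Longrightarrow> circle_mean (\<lambda>t. cmod (f (of_real r * t)) powr p) \<le> M"
  using assms unfolding mem_hardy_space_iff by blast

text \<open>Only finitely many zeros lie in a compact subdisk, so they meet only finitely many circles.\<close>

lemma holomorphic_zero_free_radius:
  assumes f: "f holomorphic_on unit_disk" and nz: "z0 \<in> unit_disk" "f z0 \<noteq> 0" and c: "c < 1"
  obtains r where "0 < r" "c < r" "r < 1" "\<And>z. cmod z = r \<Longrightarrow> f z \<noteq> 0"
proof -
  define d where "d = (1 + max 0 c) / 2"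
  have d: "max 0 c < d" "d < 1" using c by (auto simp: d_def)
  have "finite {z \<in> cball 0 d. f z = 0}"
  proof (cases "f constant_on unit_disk")
    case True
    then have "f z \<noteq> 0" if "z \<in> cball 0 d" for z
      using nz that d unfolding constant_on_def by force
    then have "{z \<in> cball 0 d. f z = 0} = {}" by blast
    then show ?thesis by (simp only: finite.emptyI)
  next
    case False
    then show ?thesis
      using d by (intro holomorphic_compact_finite_zeros[OF f]) auto
  qed
  then have "finite (cmod ` {z \<in> cball 0 d. f z = 0})" by (rule finite_imageI)
  moreover have "infinite {max 0 c<..<d}" using d by (simp add: infinite_Ioo)
  ultimately have "infinite ({max 0 c<..<d} - cmod ` {z \<in> cball 0 d. f z = 0})"
    by (rule Diff_infinite_finite)
  then obtain r where "r \<in> {max 0 c<..<d} - cmod ` {z \<in> cball 0 d. f z = 0}"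
    using infinite_imp_nonempty by blast
  then show ?thesis using d by (intro that[of r]) auto
qed

text \<open>The bound for dilations does not depend on the dilation factor \<open>r\<close>.  It holds for a set of \<open>r\<close>
  accumulating at one, where \<open>f\<close> has no zeros of modulus \<open>r\<close>, and passes to \<open>r = 1\<close> by continuity.\<close>

lemma hardy_space_compose:
  assumes p: "0 < p" and f: "f \<in> hardy_space p"
    and \<phi>: "\<phi> holomorphic_on unit_disk" "\<phi> \<in> unit_disk \<rightarrow> unit_disk"
  shows "composition_operator \<phi> f \<in> hardy_space p"
proof -
  obtain M where fh: "f holomorphic_on unit_disk"
    and M: "\<And>r. 0 \<le> r \<Longrightarrow> r < 1 \<Longrightarrow> circle_mean (\<lambda>t. cmod (f (of_real r * t)) powr p) \<le> M"
    using hardy_spaceE[OF f] by blast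
  define C where "C = (1 + cmod (\<phi> 0)) / (1 - cmod (\<phi> 0))"
  have "cmod (\<phi> 0) < 1" using \<phi>(2) by (auto simp: Pi_iff)
  then have C: "0 \<le> C" by (simp add: C_def)
  have fc: "continuous_on unit_disk f" using fh by (rule holomorphic_on_imp_continuous_on)
  have comp_h: "(\<lambda>z. f (\<phi> z)) holomorphic_on unit_disk"
    using \<phi> by (intro holomorphic_on_compose_gen[OF \<phi>(1) fh, unfolded o_def]) auto
  have bound: "circle_mean (\<lambda>\<zeta>. cmod (f (\<phi> (of_real \<rho> * \<zeta>))) powr p) \<le> C * M"
    if \<rho>: "0 \<le> \<rho>" "\<rho> < 1" for \<rho>
  proof (cases "\<exists>z0 \<in> unit_disk. f z0 \<noteq> 0")
    case False
    have "cmod (\<phi> (of_real \<rho> * \<zeta>)) < 1" if "cmod \<zeta> = 1" for \<zeta>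
      using \<phi>(2) \<rho> that by (auto simp: Pi_iff norm_mult)
    then have "circle_mean (\<lambda>\<zeta>. cmod (f (\<phi> (of_real \<rho> * \<zeta>))) powr p) = circle_mean (\<lambda>_. 0)"
      using False by (intro circle_mean_cong) auto
    moreover have "circle_mean (\<lambda>t. cmod (f (of_real 0 * t)) powr p) \<le> M" by (rule M) auto
    then have "0 \<le> M" by (rule order_trans[rotated]) simp
    ultimately show ?thesis using C by simp
  next
    case True
    then obtain z0 where z0: "z0 \<in> unit_disk" "f z0 \<noteq> 0" by blast
    define m where "m = (\<lambda>r. circle_mean (\<lambda>\<zeta>. cmod (f (of_real r * \<phi> (of_real \<rho> * \<zeta>))) powr p))"
    have u1: "cmod (\<phi> (of_real \<rho> * \<zeta>)) < 1" if "cmod \<zeta> = 1" for \<zeta>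
      using \<phi>(2) \<rho> that by (auto simp: Pi_iff norm_mult)
    have uc: "continuous_on unit_circle (\<lambda>\<zeta>. \<phi> (of_real \<rho> * \<zeta>))"
      by (rule continuous_on_compose2[OF holomorphic_on_imp_continuous_on[OF \<phi>(1)]])
         (use \<rho> in \<open>auto intro!: continuous_intros simp: norm_mult\<close>)
    have "continuous_on ({0..1} \<times> unit_circle) (\<lambda>x. of_real (fst x) * \<phi> (of_real \<rho> * snd x))"
      by (intro continuous_intros continuous_on_compose2[OF uc]) auto
    moreover have "of_real (fst x) * \<phi> (of_real \<rho> * snd x) \<in> unit_disk" if "x \<in> {0..1} \<times> unit_circle" for x
    proof -
      have "cmod (of_real (fst x) * \<phi> (of_real \<rho> * snd x)) \<le> 1 * cmod (\<phi> (of_real \<rho> * snd x))"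
        unfolding norm_mult using that by (intro mult_right_mono) auto
      then show ?thesis using u1[of "snd x"] that by (auto simp: mem_Times_iff)
    qed
    ultimately have "continuous_on ({0..1} \<times> unit_circle) (\<lambda>x. f (of_real (fst x) * \<phi> (of_real \<rho> * snd x)))"
      by (intro continuous_on_compose2[OF fc]) auto
    then have mc: "continuous_on {0..1} m"
      unfolding m_def using p
      by (intro continuous_on_circle_mean)
         (auto simp: case_prod_unfold intro!: continuous_on_norm_powr)
    show ?thesis
    proof (rule ccontr)
      assume "\<not> ?thesis"
      then have "0 < m 1 - C * M" by (simp add: m_def)
      moreover have "\<forall>e>0. \<exists>d>0. \<forall>r\<in>{0..1}. dist r 1 < d \<longrightarrow> dist (m r) (m 1) < e"
        using mc unfolding continuous_on_iff by (rule bspec) simp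
      ultimately obtain d where d: "0 < d" "\<And>r. r \<in> {0..1} \<Longrightarrow> dist r 1 < d \<Longrightarrow> dist (m r) (m 1) < m 1 - C * M"
        by blast
      \<comment> \<open>A radius so close to one that \<open>m r\<close> still exceeds the bound, but without zeros of \<open>f\<close>.\<close>
      obtain r where r: "0 < r" "1 - d < r" "r < 1" "\<And>z. cmod z = r \<Longrightarrow> f z \<noteq> 0"
        using holomorphic_zero_free_radius[OF fh z0, of "1 - d"] d(1) by auto
      have "m r \<le> C * circle_mean (\<lambda>t. cmod (f (of_real r * t)) powr p)"
        unfolding m_def C_def by (rule hardy_space_compose_dilated[OF p fh \<phi> r(1,3,4) \<rho>])
      also have "\<dots> \<le> C * M" using C r M by (intro mult_left_mono) auto
      finally show False using d(2)[of r] r by (auto simp: dist_real_def abs_if split: if_splits)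
    qed
  qed
  show ?thesis
  proof (rule hardy_spaceI)
    show "composition_operator \<phi> f \<in> extensional unit_disk"
      by (simp add: composition_operator_def compose_def)
    show "composition_operator \<phi> f holomorphic_on unit_disk"
      using comp_h by (rule holomorphic_transform) (simp add: composition_operator_def compose_def)
    fix r :: real assume r: "0 \<le> r" "r < 1"
    have "circle_mean (\<lambda>t. cmod (composition_operator \<phi> f (of_real r * t)) powr p)
        = circle_mean (\<lambda>\<zeta>. cmod (f (\<phi> (of_real r * \<zeta>))) powr p)"
      using r by (intro circle_mean_cong) (simp add: composition_operator_def compose_def norm_mult)
    then show "circle_mean (\<lambda>t. cmod (composition_operator \<phi> f (of_real r * t)) powr p) \<le> C * M"
      using bound[OF r] by simp
  qed
qed

section \<open>Poisson integrals of measures and singular inner functions\<close>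

definition circle_measure :: "complex measure \<Rightarrow> bool" where
  "circle_measure \<sigma> \<longleftrightarrow> sets \<sigma> = sets circle_borel \<and> finite_measure \<sigma>"

definition poisson_integral :: "complex measure \<Rightarrow> complex \<Rightarrow> real" where
  "poisson_integral \<sigma> z = (LINT t|\<sigma>. poisson_kernel t z)"

lemma circle_measure_space: "circle_measure \<sigma> \<Longrightarrow> space \<sigma> = unit_circle"
  unfolding circle_measure_def using sets_eq_imp_space_eq[of \<sigma> circle_borel] by simp

lemma circle_measure_measurable_cong:
  "circle_measure \<sigma> \<Longrightarrow> measurable \<sigma> N = measurable circle_borel N"
  unfolding circle_measure_def by (intro measurable_cong_sets) auto

lemma borel_measurable_circle:
  "f \<in> borel_measurable borel \<Longrightarrow> f \<in> borel_measurable circle_borel"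
  unfolding circle_borel_def by (rule measurable_restrict_space1)

lemma borel_measurable_circle_continuous:
  "continuous_on unit_circle f \<Longrightarrow> f \<in> borel_measurable circle_borel"
  unfolding circle_borel_def by (rule borel_measurable_continuous_on_restrict)

lemma continuous_on_circle_bounded:
  assumes "continuous_on unit_circle f"
  obtains B where "\<And>t. cmod t = 1 \<Longrightarrow> norm (f t) \<le> B"
proof -
  have "compact (f ` unit_circle)" using assms by (intro compact_continuous_image) auto
  then have "bounded (f ` unit_circle)" by (rule compact_imp_bounded)
  then obtain B where "\<forall>y \<in> f ` unit_circle. norm y \<le> B"
    unfolding bounded_iff by (rule exE)
  then show ?thesis by (intro that[of B]) simp
qed

lemma borel_measurable_poisson_kernel:
  "cmod z < 1 \<Longrightarrow> (\<lambda>t. ennreal (poisson_kernel t z)) \<in> borel_measurable circle_borel"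
  by (intro measurable_compose[OF borel_measurable_circle_continuous measurable_ennreal]
      continuous_on_poisson_kernel_circle)

lemma integrable_circle_continuous:
  fixes f :: "complex \<Rightarrow> 'b::{banach, second_countable_topology}"
  assumes \<sigma>: "circle_measure \<sigma>" and f: "continuous_on unit_circle f"
  shows "integrable \<sigma> f"
proof -
  interpret finite_measure \<sigma> using \<sigma> by (simp add: circle_measure_def)
  obtain B where B: "\<And>t. cmod t = 1 \<Longrightarrow> norm (f t) \<le> B"
    using continuous_on_circle_bounded[OF f] by blast
  show ?thesis
  proof (rule integrable_const_bound)
    show "AE x in \<sigma>. norm (f x) \<le> B"
      using B by (intro AE_I2) (simp add: circle_measure_space[OF \<sigma>])
    show "f \<in> borel_measurable \<sigma>"
      unfolding circle_measure_measurable_cong[OF \<sigma>] by (rule borel_measurable_circle_continuous[OF f])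
  qed
qed

lemma circle_integral_cong:
  assumes "circle_measure \<sigma>" "\<And>t. cmod t = 1 \<Longrightarrow> f t = g t"
  shows "integral\<^sup>L \<sigma> f = integral\<^sup>L \<sigma> g"
  using assms by (intro Bochner_Integration.integral_cong) (auto simp: circle_measure_space)

lemma circle_nn_integral_cong:
  assumes "circle_measure \<sigma>" "\<And>t. cmod t = 1 \<Longrightarrow> f t = g t"
  shows "integral\<^sup>N \<sigma> f = integral\<^sup>N \<sigma> g"
  using assms by (intro nn_integral_cong) (auto simp: circle_measure_space)

lemma continuous_on_herglotz_kernel:
  "cmod z < 1 \<Longrightarrow> continuous_on unit_circle (\<lambda>t. (t + z) / (t - z))"
  by (intro continuous_intros) auto

lemma norm_singular_inner:
  assumes \<mu>: "circle_measure \<mu>" and z: "cmod z < 1"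
  shows "cmod (singular_inner \<alpha> \<mu> z) = cmod \<alpha> * exp (- poisson_integral \<mu> z)"
proof -
  have "Re (LINT t|\<mu>. (t + z) / (t - z)) = (LINT t|\<mu>. Re ((t + z) / (t - z)))"
    by (rule integral_Re[symmetric]) (intro integrable_circle_continuous \<mu> continuous_on_herglotz_kernel z)
  also have "\<dots> = poisson_integral \<mu> z"
    unfolding poisson_integral_def by (rule circle_integral_cong[OF \<mu>]) (simp only: Re_herglotz_kernel z)
  finally show ?thesis by (simp add: singular_inner_def norm_mult)
qed

text \<open>Differentiation under the integral sign.  The difference quotient of \<open>(t + z) / (t - z)\<close> is
  \<open>2 * t / ((t - w) * (t - z))\<close>, which differs from its limit by \<open>O(cmod (w - z))\<close> uniformly
  in \<open>t\<close> on the circle.\<close>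

lemma herglotz_integral_has_field_derivative:
  assumes \<sigma>: "circle_measure \<sigma>" and z: "cmod z < 1"
  shows "((\<lambda>z. LINT t|\<sigma>. (t + z) / (t - z)) has_field_derivative (LINT t|\<sigma>. 2 * t / (t - z)\<^sup>2)) (at z)"
proof -
  define H where "H = (\<lambda>z. LINT t|\<sigma>. (t + z) / (t - z))"
  define D where "D = (LINT t|\<sigma>. 2 * t / (t - z)\<^sup>2)"
  define d where "d = (1 - cmod z) / 2"
  have d: "0 < d" using z by (simp add: d_def)
  define K where "K = (LINT t|\<sigma>. 2 / d ^ 3)"
  have intD: "integrable \<sigma> (\<lambda>t. 2 * t / (t - z)\<^sup>2)"
    using z by (intro integrable_circle_continuous \<sigma> continuous_intros) auto
  have est: "norm ((H w - H z) / (w - z) - D) \<le> K * norm (w - z)" if w: "w \<noteq> z" "dist w z < d" for w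
  proof -
    have w1: "cmod w < 1"
      using norm_triangle_ineq[of z "w - z"] w(2) z by (simp add: d_def dist_norm field_simps)
    let ?q = "\<lambda>t. 2 * t * (w - z) / ((t - w) * (t - z)\<^sup>2)"
    have intq: "integrable \<sigma> ?q"
      using z w1 by (intro integrable_circle_continuous \<sigma> continuous_intros) auto
    have "(H w - H z) / (w - z) - D =
        (LINT t|\<sigma>. ((t + w) / (t - w) - (t + z) / (t - z)) / (w - z) - 2 * t / (t - z)\<^sup>2)"
      unfolding H_def D_def
      using integrable_circle_continuous[OF \<sigma> continuous_on_herglotz_kernel[OF w1]]
        integrable_circle_continuous[OF \<sigma> continuous_on_herglotz_kernel[OF z]] intD
      by simp
    also have "\<dots> = integral\<^sup>L \<sigma> ?q"
    proof (rule circle_integral_cong[OF \<sigma>])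
      fix t :: complex assume t: "cmod t = 1"
      define a where "a = t - w"
      define b where "b = t - z"
      have nz: "a \<noteq> 0" "b \<noteq> 0" using t w1 z by (auto simp: a_def b_def)
      have e: "w = t - a" "z = t - b" by (simp_all add: a_def b_def)
      have "b - a \<noteq> 0" using w(1) by (simp add: a_def b_def)
      moreover have "((2 * t - a) / a - (2 * t - b) / b) = 2 * t * (b - a) / (a * b)"
        using nz by (simp add: field_simps)
      ultimately have "((2 * t - a) / a - (2 * t - b) / b) / (b - a) = 2 * t / (a * b)"
        by simp
      moreover have "2 * t / (a * b) - 2 * t / b\<^sup>2 = 2 * t * (b - a) / (a * b\<^sup>2)"
        using nz by (simp add: field_simps power2_eq_square)
      ultimately have "((2 * t - a) / a - (2 * t - b) / b) / (b - a) - 2 * t / b\<^sup>2 = 2 * t * (b - a) / (a * b\<^sup>2)"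
        by simp
      then show "((t + w) / (t - w) - (t + z) / (t - z)) / (w - z) - 2 * t / (t - z)\<^sup>2 = ?q t"
        unfolding e by simp
    qed
    finally have "norm ((H w - H z) / (w - z) - D) = norm (integral\<^sup>L \<sigma> ?q)" by simp
    also have "\<dots> \<le> (LINT t|\<sigma>. norm (?q t))" by (rule integral_norm_bound)
    also have "\<dots> \<le> (LINT t|\<sigma>. norm (w - z) * (2 / d ^ 3))"
    proof (rule integral_mono_AE)
      show "AE t in \<sigma>. norm (?q t) \<le> norm (w - z) * (2 / d ^ 3)"
      proof (rule AE_I2)
        fix t assume "t \<in> space \<sigma>"
        then have t: "cmod t = 1" using circle_measure_space[OF \<sigma>] by simp
        have dz: "d \<le> cmod (t - z)" using norm_triangle_ineq2[of t z] t z by (simp add: d_def)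
        have dw: "d \<le> cmod (t - w)"
          using norm_triangle_ineq2[of t w] norm_triangle_ineq[of z "w - z"] t w(2)
          by (simp add: d_def dist_norm field_simps)
        from this have "d * d\<^sup>2 \<le> cmod (t - w) * (cmod (t - z))\<^sup>2"
          using dz d by (intro mult_mono power_mono) auto
        then have "norm (?q t) \<le> 2 * norm (w - z) / (d * d\<^sup>2)"
          unfolding norm_mult norm_divide norm_power using t d dz dw
          by (simp only: mult_1_right norm_numeral, intro divide_left_mono mult_pos_pos)
             (auto intro: less_le_trans)
        also have "2 * norm (w - z) / (d * d\<^sup>2) = norm (w - z) * (2 / d ^ 3)"
          by (simp add: power3_eq_cube power2_eq_square mult.assoc mult.commute[of 2])
        finally show "norm (?q t) \<le> norm (w - z) * (2 / d ^ 3)" .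
      qed
    qed (intro integrable_norm intq, intro integrable_circle_continuous \<sigma> continuous_on_const)
    also have "\<dots> = K * norm (w - z)" by (simp add: K_def)
    finally show ?thesis .
  qed
  have "((\<lambda>w. (H w - H z) / (w - z) - D) \<longlongrightarrow> 0) (at z)"
  proof (rule Lim_null_comparison)
    show "\<forall>\<^sub>F w in at z. norm ((H w - H z) / (w - z) - D) \<le> K * norm (w - z)"
      unfolding eventually_at by (rule exI[of _ d]) (use est d in auto)
    show "((\<lambda>w. K * norm (w - z)) \<longlongrightarrow> 0) (at z)"
      by (intro tendsto_mult_right_zero tendsto_norm_zero LIM_zero tendsto_ident_at)
  qed
  then have "((\<lambda>w. (H w - H z) / (w - z)) \<longlongrightarrow> D) (at z)"
    by (rule LIM_zero_cancel)
  then show ?thesis by (simp add: has_field_derivative_iff H_def D_def)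
qed

lemma holomorphic_on_singular_inner:
  assumes "circle_measure \<mu>"
  shows "singular_inner \<alpha> \<mu> holomorphic_on unit_disk"
proof -
  define H where "H = (\<lambda>z. LINT t|\<mu>. (t + z) / (t - z))"
  define D where "D = (\<lambda>z. LINT t|\<mu>. 2 * t / (t - z)\<^sup>2)"
  have "(H has_field_derivative D z) (at z)" if "cmod z < 1" for z
    unfolding H_def D_def by (rule herglotz_integral_has_field_derivative[OF assms that])
  then have "(H has_field_derivative D z) (at z within unit_disk)" if "z \<in> unit_disk" for z
    using that by (simp add: has_field_derivative_at_within)
  then have "H holomorphic_on unit_disk"
    unfolding holomorphic_on_def field_differentiable_def by blast
  then have "(\<lambda>z. \<alpha> * exp (- H z)) holomorphic_on unit_disk"
    by (intro holomorphic_intros)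
  then show ?thesis by (rule holomorphic_transform) (simp only: singular_inner_def H_def)
qed

section \<open>Transport of measures by disk involutions and rotations\<close>

lemma blaschke_swap [simp]: "blaschke a 0 = a" "blaschke a a = 0"
  by (simp_all add: blaschke_def)

lemma blaschke_in_disk:
  assumes "cmod a < 1" "cmod z < 1"
  shows "cmod (blaschke a z) < 1"
proof -
  have "0 < (1 - (cmod a)\<^sup>2) * (1 - (cmod z)\<^sup>2)"
    using assms by (simp add: abs_square_less_1)
  then have "(cmod (a - z))\<^sup>2 < (cmod (1 - cnj a * z))\<^sup>2"
    using norm_blaschke_parts[of a z] by linarith
  then have "cmod (a - z) < cmod (1 - cnj a * z)"
    by (rule power_less_imp_less_base) simp
  then show ?thesis by (simp add: blaschke_def norm_divide divide_less_eq_1)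
qed

lemma holomorphic_on_blaschke:
  assumes "cmod a < 1"
  shows "blaschke a holomorphic_on unit_disk"
  unfolding blaschke_def[abs_def] using blaschke_denom_nonzero[OF assms]
  by (intro holomorphic_intros) auto

text \<open>Conformal invariance: \<open>t - blaschke \<omega> z\<close> and \<open>blaschke \<omega> t - z\<close> have, up to sign, the same
  numerator \<open>N\<close>, and the factor \<open>poisson_kernel t \<omega>\<close> is the modulus of the derivative of \<open>blaschke \<omega>\<close> on the
  circle.\<close>

lemma poisson_kernel_blaschke:
  assumes \<omega>: "cmod \<omega> < 1" and z: "cmod z < 1" and t: "cmod t = 1"
  shows "poisson_kernel (blaschke \<omega> t) z * poisson_kernel t \<omega> = poisson_kernel t (blaschke \<omega> z)"
proof -
  define N where "N = cmod (t - \<omega> + z - cnj \<omega> * t * z)"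
  have dz: "1 - cnj \<omega> * z \<noteq> 0" and dt: "1 - cnj \<omega> * t \<noteq> 0"
    using blaschke_denom_nonzero[OF \<omega>] z t by auto
  have "t - blaschke \<omega> z = (t - \<omega> + z - cnj \<omega> * t * z) / (1 - cnj \<omega> * z)"
    using dz by (simp add: blaschke_def field_simps)
  then have 1: "cmod (t - blaschke \<omega> z) = N / cmod (1 - cnj \<omega> * z)"
    by (simp add: N_def norm_divide)
  have "blaschke \<omega> t - z = - (t - \<omega> + z - cnj \<omega> * t * z) / (1 - cnj \<omega> * t)"
    using dt by (simp add: blaschke_def field_simps)
  then have 2: "cmod (blaschke \<omega> t - z) = N / cmod (1 - cnj \<omega> * t)"
    by (simp only: N_def norm_divide norm_minus_cancel)
  have "(cmod (t - \<omega>))\<^sup>2 = (cmod (1 - cnj \<omega> * t))\<^sup>2"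
    using norm_blaschke_parts[of \<omega> t] t by (simp add: norm_minus_commute)
  then have 3: "poisson_kernel t \<omega> = (1 - (cmod \<omega>)\<^sup>2) / (cmod (1 - cnj \<omega> * t))\<^sup>2"
    by (simp add: poisson_kernel_def)
  have "1 - (cmod (blaschke \<omega> z))\<^sup>2 =
      ((cmod (1 - cnj \<omega> * z))\<^sup>2 - (cmod (\<omega> - z))\<^sup>2) / (cmod (1 - cnj \<omega> * z))\<^sup>2"
  proof -
    have "(cmod (blaschke \<omega> z))\<^sup>2 = (cmod (\<omega> - z))\<^sup>2 / (cmod (1 - cnj \<omega> * z))\<^sup>2"
      by (simp add: blaschke_def norm_divide power_divide)
    moreover have "(cmod (1 - cnj \<omega> * z))\<^sup>2 / (cmod (1 - cnj \<omega> * z))\<^sup>2 = 1"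
      using dz by (intro divide_self) auto
    ultimately show ?thesis by (simp only: diff_divide_distrib)
  qed
  then have 4: "1 - (cmod (blaschke \<omega> z))\<^sup>2 = (1 - (cmod \<omega>)\<^sup>2) * (1 - (cmod z)\<^sup>2) / (cmod (1 - cnj \<omega> * z))\<^sup>2"
    by (simp add: norm_blaschke_parts)
  show ?thesis
    unfolding 3 unfolding poisson_kernel_def 1 2 4 using dz dt
    by (simp add: power_divide)
qed

lemma poisson_kernel_blaschke_inverse:
  assumes "cmod \<omega> < 1" "cmod t = 1"
  shows "poisson_kernel (blaschke \<omega> t) \<omega> * poisson_kernel t \<omega> = 1"
  using poisson_kernel_blaschke[OF assms(1) assms(1) assms(2)] assms by simp

lemma sets_transported_measure [simp]:
  "sets (transported_measure \<omega> \<mu>) = sets circle_borel"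
  unfolding transported_measure_def
  using sets.sigma_sets_eq[of circle_borel] sets_circle_borel_subset
  by (subst sets_measure_of) auto

text \<open>Together with the invariance of the kernel, this form makes \<open>transported_measure \<omega> \<mu>\<close> the
  measure whose Poisson integral is that of \<open>\<mu>\<close> composed with \<open>blaschke \<omega>\<close>.\<close>

lemma transported_measure_eq_distr:
  assumes \<omega>: "cmod \<omega> < 1" and \<mu>: "circle_measure \<mu>"
  shows "transported_measure \<omega> \<mu> =
    distr (density \<mu> (\<lambda>t. ennreal (poisson_kernel t \<omega>))) circle_borel (blaschke \<omega>)"
proof (rule measure_eqI)
  fix E assume "E \<in> sets (transported_measure \<omega> \<mu>)"
  then have E: "E \<in> sets circle_borel" by simp
  have s: "sets \<mu> = sets circle_borel" using \<mu> by (simp add: circle_measure_def)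
  have k: "(\<lambda>t. ennreal (poisson_kernel t \<omega>)) \<in> borel_measurable \<mu>"
    unfolding circle_measure_measurable_cong[OF \<mu>] by (rule borel_measurable_poisson_kernel[OF \<omega>])
  have B: "blaschke \<omega> \<in> measurable (density \<mu> k) circle_borel" for k
    using blaschke_measurable[OF \<omega>] measurable_cong_sets[of "density \<mu> k" circle_borel circle_borel]
    by (simp add: s)
  have im: "blaschke \<omega> ` E = blaschke \<omega> -` E \<inter> unit_circle"
    using blaschke_image_circle[OF \<omega> sets_circle_borel_subset[OF E]] .
  then have "blaschke \<omega> ` E \<in> sets \<mu>"
    using measurable_sets[OF blaschke_measurable[OF \<omega>] E] by (simp add: s)
  then show "emeasure (transported_measure \<omega> \<mu>) E =
      emeasure (distr (density \<mu> (\<lambda>t. ennreal (poisson_kernel t \<omega>))) circle_borel (blaschke \<omega>)) E"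
    using \<omega> E im k
    by (subst emeasure_transported_measure)
       (auto simp: s emeasure_distr[OF B] emeasure_density circle_measure_space[OF \<mu>] poisson_kernel_def)
qed simp

lemma nn_integral_transported_measure:
  assumes \<omega>: "cmod \<omega> < 1" and \<mu>: "circle_measure \<mu>" and g: "g \<in> borel_measurable circle_borel"
  shows "(\<integral>\<^sup>+t. g t \<partial>transported_measure \<omega> \<mu>) =
    (\<integral>\<^sup>+t. ennreal (poisson_kernel t \<omega>) * g (blaschke \<omega> t) \<partial>\<mu>)"
proof -
  have B: "blaschke \<omega> \<in> measurable (density \<mu> k) circle_borel" for k
    using blaschke_measurable[OF \<omega>] \<mu> measurable_cong_sets[of "density \<mu> k" circle_borel circle_borel]
    by (simp add: circle_measure_def)
  have k: "(\<lambda>t. ennreal (poisson_kernel t \<omega>)) \<in> borel_measurable \<mu>"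
    unfolding circle_measure_measurable_cong[OF \<mu>] by (rule borel_measurable_poisson_kernel[OF \<omega>])
  have gB: "(\<lambda>t. g (blaschke \<omega> t)) \<in> borel_measurable \<mu>"
    unfolding circle_measure_measurable_cong[OF \<mu>]
    using measurable_compose[OF blaschke_measurable[OF \<omega>] g] .
  show ?thesis
    unfolding transported_measure_eq_distr[OF \<omega> \<mu>]
    using g by (subst nn_integral_distr[OF B]) (simp_all add: nn_integral_density[OF k gB])
qed

lemma circle_measure_transported_measure:
  assumes \<omega>: "cmod \<omega> < 1" and \<mu>: "circle_measure \<mu>"
  shows "circle_measure (transported_measure \<omega> \<mu>)"
proof -
  have "emeasure (transported_measure \<omega> \<mu>) (space (transported_measure \<omega> \<mu>)) =
      (\<integral>\<^sup>+t. 1 \<partial>transported_measure \<omega> \<mu>)" by simp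
  also have "\<dots> = (\<integral>\<^sup>+t. ennreal (poisson_kernel t \<omega>) \<partial>\<mu>)"
    by (subst nn_integral_transported_measure[OF assms]) simp_all
  also have "\<dots> < \<infinity>"
    using integrable_circle_continuous[OF \<mu> continuous_on_poisson_kernel_circle[OF \<omega>]]
    by (simp add: integrable_iff_bounded poisson_kernel_nonneg[OF \<omega>])
  finally show ?thesis
    unfolding circle_measure_def by (auto intro: finite_measureI)
qed

lemma poisson_integral_transported_measure:
  assumes \<omega>: "cmod \<omega> < 1" and \<mu>: "circle_measure \<mu>" and z: "cmod z < 1"
  shows "poisson_integral (transported_measure \<omega> \<mu>) z = poisson_integral \<mu> (blaschke \<omega> z)"
proof -
  have pm: "(\<lambda>t. poisson_kernel t w) \<in> borel_measurable circle_borel" if "cmod w < 1" for w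
    using that by (intro borel_measurable_circle_continuous continuous_on_poisson_kernel_circle)
  have *: "poisson_integral \<sigma> w = enn2real (\<integral>\<^sup>+t. ennreal (poisson_kernel t w) \<partial>\<sigma>)"
    if "circle_measure \<sigma>" "cmod w < 1" for \<sigma> w
    unfolding poisson_integral_def using that pm[OF that(2)]
    by (intro integral_eq_nn_integral) (auto simp: circle_measure_measurable_cong poisson_kernel_nonneg)
  have "(\<integral>\<^sup>+t. ennreal (poisson_kernel t z) \<partial>transported_measure \<omega> \<mu>) =
      (\<integral>\<^sup>+t. ennreal (poisson_kernel t \<omega>) * ennreal (poisson_kernel (blaschke \<omega> t) z) \<partial>\<mu>)"
    by (rule nn_integral_transported_measure[OF \<omega> \<mu>])
       (rule borel_measurable_poisson_kernel[OF z])
  also have "\<dots> = (\<integral>\<^sup>+t. ennreal (poisson_kernel t (blaschke \<omega> z)) \<partial>\<mu>)"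
  proof (rule circle_nn_integral_cong[OF \<mu>])
    fix t :: complex assume "cmod t = 1"
    then have "poisson_kernel t (blaschke \<omega> z) = poisson_kernel t \<omega> * poisson_kernel (blaschke \<omega> t) z"
      using poisson_kernel_blaschke[OF \<omega> z] by (simp add: mult.commute)
    then show "ennreal (poisson_kernel t \<omega>) * ennreal (poisson_kernel (blaschke \<omega> t) z)
        = ennreal (poisson_kernel t (blaschke \<omega> z))"
      by (simp add: ennreal_mult poisson_kernel_nonneg \<omega> z)
  qed
  finally show ?thesis
    using *[OF \<mu> blaschke_in_disk[OF \<omega> z]] *[OF circle_measure_transported_measure[OF \<omega> \<mu>] z] by simp
qed

text \<open>The two densities cancel, since \<open>poisson_kernel t \<omega>\<close> is the modulus of the derivative of an involution.\<close>

lemma transported_measure_involution: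
  assumes \<omega>: "cmod \<omega> < 1" and \<mu>: "circle_measure \<mu>"
  shows "transported_measure \<omega> (transported_measure \<omega> \<mu>) = \<mu>"
proof (rule measure_eqI)
  note T = circle_measure_transported_measure[OF \<omega> \<mu>]
  have k: "(\<lambda>t. ennreal (poisson_kernel t \<omega>)) \<in> borel_measurable circle_borel"
    by (rule borel_measurable_poisson_kernel[OF \<omega>])
  fix E assume "E \<in> sets (transported_measure \<omega> (transported_measure \<omega> \<mu>))"
  then have E: "E \<in> sets circle_borel" by simp
  then have "E \<in> sets \<mu>" using \<mu> by (simp add: circle_measure_def)
  have ind: "(indicator E :: complex \<Rightarrow> ennreal) \<in> borel_measurable circle_borel"
    using E by simp
  have indB: "(\<lambda>t. indicator E (blaschke \<omega> t) :: ennreal) \<in> borel_measurable circle_borel"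
    using measurable_compose[OF blaschke_measurable[OF \<omega>] ind] .
  have "emeasure (transported_measure \<omega> (transported_measure \<omega> \<mu>)) E =
      (\<integral>\<^sup>+t. indicator E t \<partial>transported_measure \<omega> (transported_measure \<omega> \<mu>))"
    using E by (subst nn_integral_indicator) auto
  also have "\<dots> = (\<integral>\<^sup>+t. ennreal (poisson_kernel t \<omega>) * indicator E (blaschke \<omega> t) \<partial>transported_measure \<omega> \<mu>)"
    by (rule nn_integral_transported_measure[OF \<omega> T ind])
  also have "\<dots> = (\<integral>\<^sup>+t. ennreal (poisson_kernel t \<omega>) *
      (ennreal (poisson_kernel (blaschke \<omega> t) \<omega>) * indicator E (blaschke \<omega> (blaschke \<omega> t))) \<partial>\<mu>)"
    by (rule nn_integral_transported_measure[OF \<omega> \<mu>]) (intro borel_measurable_times_ennreal k indB)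
  also have "\<dots> = (\<integral>\<^sup>+t. indicator E t \<partial>\<mu>)"
  proof (rule circle_nn_integral_cong[OF \<mu>])
    fix t :: complex assume t: "cmod t = 1"
    have "ennreal (poisson_kernel t \<omega>) * ennreal (poisson_kernel (blaschke \<omega> t) \<omega>) = 1"
      using poisson_kernel_blaschke_inverse[OF \<omega> t]
      by (simp add: ennreal_mult[symmetric] poisson_kernel_nonneg \<omega> mult.commute)
    then show "ennreal (poisson_kernel t \<omega>) *
        (ennreal (poisson_kernel (blaschke \<omega> t) \<omega>) * indicator E (blaschke \<omega> (blaschke \<omega> t))) = indicator E t"
      using t by (simp add: blaschke_involution[OF \<omega>] mult.assoc[symmetric])
  qed
  also have "\<dots> = emeasure \<mu> E" using \<open>E \<in> sets \<mu>\<close> by simp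
  finally show "emeasure (transported_measure \<omega> (transported_measure \<omega> \<mu>)) E = emeasure \<mu> E" .
qed (use \<mu> in \<open>simp add: circle_measure_def\<close>)

lemma circle_measure_leI:
  assumes \<sigma>: "circle_measure \<sigma>" and \<tau>: "circle_measure \<tau>"
    and le: "\<And>E. E \<in> sets circle_borel \<Longrightarrow> emeasure \<sigma> E \<le> emeasure \<tau> E"
  shows "\<sigma> \<le> \<tau>"
proof -
  have "sets \<sigma> = sets \<tau>" using \<sigma> \<tau> by (simp add: circle_measure_def)
  moreover have "emeasure \<sigma> A \<le> emeasure \<tau> A" for A
    using le[of A] \<sigma> by (cases "A \<in> sets \<sigma>") (auto simp: circle_measure_def emeasure_notin_sets)
  ultimately show ?thesis by (simp add: le_measure le_fun_def)
qed

lemma transported_measure_mono: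
  assumes \<omega>: "cmod \<omega> < 1" and \<mu>: "circle_measure \<mu>" "circle_measure \<mu>'"
    and le: "\<And>E. E \<in> sets circle_borel \<Longrightarrow> emeasure \<mu> E \<le> emeasure \<mu>' E"
    and E: "E \<in> sets circle_borel"
  shows "emeasure (transported_measure \<omega> \<mu>) E \<le> emeasure (transported_measure \<omega> \<mu>') E"
proof -
  have s: "sets \<mu> = sets \<mu>'" using \<mu> by (simp add: circle_measure_def)
  have "\<mu> \<le> \<mu>'" using circle_measure_leI[OF \<mu>] le by blast
  then show ?thesis
    using \<omega> \<mu> E nn_integral_mono_measure[OF s]
    by (simp add: emeasure_transported_measure circle_measure_def)
qed

text \<open>The factor \<open>cnj c\<close> is the inverse of \<open>c\<close> on the circle, so that the measure of \<open>E\<close> is \<open>\<sigma> (c E)\<close>, and the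
  Poisson integral is that of \<open>\<sigma>\<close> at \<open>c * z\<close>.\<close>

definition rotated_measure :: "complex \<Rightarrow> complex measure \<Rightarrow> complex measure" where
  "rotated_measure c \<sigma> = distr \<sigma> circle_borel (\<lambda>t. cnj c * t)"

lemma rotation_measurable:
  assumes "cmod c = 1"
  shows "(\<lambda>t. c * t) \<in> measurable circle_borel circle_borel"
  unfolding circle_borel_def
  by (rule measurable_restrict_space3) (use assms in \<open>auto simp: norm_mult\<close>)

lemma circle_measure_rotated_measure:
  assumes "cmod c = 1" "circle_measure \<sigma>"
  shows "circle_measure (rotated_measure c \<sigma>)"
  using assms rotation_measurable[of "cnj c"] finite_measure.finite_measure_distr[of \<sigma> "\<lambda>t. cnj c * t" circle_borel]
  by (simp add: rotated_measure_def circle_measure_def circle_measure_measurable_cong)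

lemma emeasure_rotated_measure:
  assumes c: "cmod c = 1" and \<sigma>: "circle_measure \<sigma>" and E: "E \<in> sets circle_borel"
  shows "emeasure (rotated_measure c \<sigma>) E = emeasure \<sigma> ((\<lambda>t. c * t) ` E)"
proof -
  have cc: "c * cnj c = 1" "cnj c * c = 1" using cnj_unit_mult[OF c] by (simp_all add: mult.commute)
  have "(\<lambda>t. cnj c * t) -` E \<inter> unit_circle = (\<lambda>t. c * t) ` E"
  proof (intro equalityI subsetI)
    fix x assume "x \<in> (\<lambda>t. cnj c * t) -` E \<inter> unit_circle"
    then show "x \<in> (\<lambda>t. c * t) ` E"
      using cc by (intro image_eqI[of _ _ "cnj c * x"]) (auto simp: mult.assoc[symmetric])
  next
    fix x assume "x \<in> (\<lambda>t. c * t) ` E"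
    then show "x \<in> (\<lambda>t. cnj c * t) -` E \<inter> unit_circle"
      using cc c sets_circle_borel_subset[OF E] by (auto simp: mult.assoc[symmetric] norm_mult)
  qed
  then show ?thesis
    using rotation_measurable[of "cnj c"] c E \<sigma>
    by (simp add: rotated_measure_def emeasure_distr circle_measure_measurable_cong circle_measure_space)
qed

lemma poisson_integral_rotated_measure:
  assumes c: "cmod c = 1" and \<sigma>: "circle_measure \<sigma>" and z: "cmod z < 1"
  shows "poisson_integral (rotated_measure c \<sigma>) z = poisson_integral \<sigma> (c * z)"
proof -
  have "poisson_integral (rotated_measure c \<sigma>) z = (LINT t|\<sigma>. poisson_kernel (cnj c * t) z)"
    unfolding poisson_integral_def rotated_measure_def
    using rotation_measurable[of "cnj c"] c \<sigma> z
    by (subst integral_distr)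
       (auto simp: circle_measure_measurable_cong
         intro!: borel_measurable_circle_continuous continuous_on_poisson_kernel_circle)
  also have "\<dots> = poisson_integral \<sigma> (c * z)"
    unfolding poisson_integral_def
  proof (rule circle_integral_cong[OF \<sigma>])
    fix t :: complex
    have "cmod (cnj c * t - z) = cmod (c * (cnj c * t - z))" using c by (simp add: norm_mult)
    also have "c * (cnj c * t - z) = t - c * z"
      using cnj_unit_mult[OF c] by (simp add: right_diff_distrib mult.assoc[symmetric])
    finally show "poisson_kernel (cnj c * t) z = poisson_kernel t (c * z)"
      using c by (simp add: poisson_kernel_def norm_mult)
  qed
  finally show ?thesis .
qed

section \<open>Singular measures and Hardy space functions\<close>

lemma circle_mean_diff:
  assumes "continuous_on unit_circle f" "continuous_on unit_circle g"
  shows "circle_mean (\<lambda>t. f t - g t) = circle_mean f - circle_mean g"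
  using circle_mean_add[of f "\<lambda>t. (-1) * g t"] circle_mean_cmult[of "-1" g] assms
  by (simp add: continuous_on_minus)

lemma continuous_on_poisson_kernel_dilation:
  assumes r: "0 \<le> r" "r < 1"
  shows "continuous_on (unit_circle \<times> unit_circle) (\<lambda>x. poisson_kernel (snd x) (of_real r * fst x))"
  unfolding poisson_kernel_def
  using circle_disk_distinct[of "snd x" "of_real r * fst x" for x :: "complex \<times> complex"] r
  by (intro continuous_intros) (auto simp: norm_mult)

text \<open>A quantitative approximate identity.  For \<open>h > 0\<close>, \<open>cmod (\<zeta> - t) \<le> h / 2 + (cmod (\<zeta> - t))\<^sup>2 / (2 * h)\<close>, and
  on the circle \<open>(cmod (\<zeta> - t))\<^sup>2 = Re (2 - 2 * cnj t * \<zeta>)\<close> is the real part of a polynomial, whose Poisson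
  integral at \<open>r * t\<close> is \<open>2 - 2 * r\<close>.  The choice \<open>h = sqrt (1 - r)\<close> balances the two terms, and no splitting
  of the circle into arcs is needed.\<close>

lemma circle_mean_poisson_lipschitz:
  assumes \<eta>: "\<And>x y. cmod x = 1 \<Longrightarrow> cmod y = 1 \<Longrightarrow> \<bar>\<eta> x - \<eta> y\<bar> \<le> L * cmod (x - y)"
    and cont: "continuous_on unit_circle \<eta>" and L: "0 \<le> L"
    and t: "cmod t = 1" and r: "0 \<le> r" "r < 1"
  shows "\<bar>circle_mean (\<lambda>\<zeta>. \<eta> \<zeta> * poisson_kernel \<zeta> (of_real r * t)) - \<eta> t\<bar> \<le> 3 / 2 * L * sqrt (1 - r)"
proof -
  define w where "w = of_real r * t"
  have w: "cmod w < 1" using t r by (simp add: w_def norm_mult)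
  note Pc = continuous_on_poisson_kernel_circle[OF w]
  define h where "h = sqrt (1 - r)"
  have h: "0 < h" "h\<^sup>2 = 1 - r" using r by (simp_all add: h_def)
  define q where "q = (\<lambda>\<zeta>. (L * (h / 2) + L / (2 * h) * Re (2 - 2 * cnj t * \<zeta>)) * poisson_kernel \<zeta> w)"
  have qc: "continuous_on unit_circle q" unfolding q_def by (intro continuous_intros Pc)
  have hol: "(\<lambda>\<zeta>. 2 - 2 * cnj t * \<zeta>) holomorphic_on cball 0 1" by (intro holomorphic_intros)
  have "circle_mean q = circle_mean (\<lambda>\<zeta>. L * (h / 2) * poisson_kernel \<zeta> w
      + L / (2 * h) * (Re (2 - 2 * cnj t * \<zeta>) * poisson_kernel \<zeta> w))"
    unfolding q_def by (simp add: algebra_simps)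
  also have "\<dots> = L * (h / 2) * 1 + L / (2 * h) * Re (2 - 2 * cnj t * w)"
    unfolding circle_mean_poisson_kernel[OF w, symmetric] circle_mean_poisson_holomorphic[OF hol w, symmetric]
      circle_mean_cmult[symmetric]
    by (intro circle_mean_add continuous_intros Pc)
  also have "Re (2 - 2 * cnj t * w) = 2 * h\<^sup>2"
  proof -
    have "2 - 2 * cnj t * w = of_real (2 - 2 * r)"
      using cnj_unit_mult[OF t] by (simp add: w_def algebra_simps)
    then have "Re (2 - 2 * cnj t * w) = 2 - 2 * r" by (simp only: Re_complex_of_real)
    then show ?thesis by (simp add: h)
  qed
  finally have mq: "circle_mean q = 3 / 2 * L * h"
    using h by (simp add: power2_eq_square field_simps)
  have bound: "\<bar>(\<eta> \<zeta> - \<eta> t) * poisson_kernel \<zeta> w\<bar> \<le> q \<zeta>" if z: "cmod \<zeta> = 1" for \<zeta>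
  proof -
    define d where "d = cmod (\<zeta> - t)"
    have "d\<^sup>2 = Re (2 - 2 * cnj t * \<zeta>)"
    proof -
      have "(Re t)\<^sup>2 + (Im t)\<^sup>2 = 1" "(Re \<zeta>)\<^sup>2 + (Im \<zeta>)\<^sup>2 = 1"
        using t z by (simp_all add: cmod_power2[symmetric])
      then show ?thesis
        unfolding d_def cmod_power2 by (simp add: power2_eq_square algebra_simps)
    qed
    moreover have "d \<le> h / 2 + d\<^sup>2 / (2 * h)"
    proof -
      have "0 \<le> (d - h)\<^sup>2" by simp
      then have "2 * h * d \<le> h\<^sup>2 + d\<^sup>2" by (simp add: power2_eq_square algebra_simps)
      then show ?thesis using h(1) by (simp add: field_simps power2_eq_square)
    qed
    ultimately have "L * d \<le> L * (h / 2 + Re (2 - 2 * cnj t * \<zeta>) / (2 * h))"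
      using L by (intro mult_left_mono) auto
    then have "\<bar>\<eta> \<zeta> - \<eta> t\<bar> \<le> L * (h / 2) + L / (2 * h) * Re (2 - 2 * cnj t * \<zeta>)"
      using \<eta>[OF z t] by (simp add: d_def distrib_left)
    then show ?thesis
      unfolding q_def abs_mult using poisson_kernel_nonneg[OF w] by (simp add: mult_right_mono)
  qed
  have c: "continuous_on unit_circle (\<lambda>\<zeta>. (\<eta> \<zeta> - \<eta> t) * poisson_kernel \<zeta> w)"
    by (intro continuous_intros cont Pc)
  have "circle_mean (\<lambda>\<zeta>. (\<eta> \<zeta> - \<eta> t) * poisson_kernel \<zeta> w) \<le> circle_mean q"
    using bound by (intro circle_mean_mono c qc) (simp add: abs_le_iff)
  moreover have "circle_mean (\<lambda>\<zeta>. (-1) * ((\<eta> \<zeta> - \<eta> t) * poisson_kernel \<zeta> w)) \<le> circle_mean q"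
    using bound by (intro circle_mean_mono continuous_on_mult continuous_on_const c qc) (simp add: abs_le_iff)
  moreover have "circle_mean (\<lambda>\<zeta>. (\<eta> \<zeta> - \<eta> t) * poisson_kernel \<zeta> w)
      = circle_mean (\<lambda>\<zeta>. \<eta> \<zeta> * poisson_kernel \<zeta> w) - \<eta> t"
  proof -
    have "circle_mean (\<lambda>\<zeta>. \<eta> \<zeta> * poisson_kernel \<zeta> w - \<eta> t * poisson_kernel \<zeta> w)
        = circle_mean (\<lambda>\<zeta>. \<eta> \<zeta> * poisson_kernel \<zeta> w) - \<eta> t"
      using circle_mean_poisson_kernel[OF w]
      by (subst circle_mean_diff) (auto intro!: continuous_intros cont Pc simp: circle_mean_cmult)
    then show ?thesis by (simp add: left_diff_distrib)
  qed
  ultimately show ?thesis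
    unfolding circle_mean_cmult mq h_def[symmetric] w_def[symmetric] by linarith
qed

abbreviation angle_measure :: "real measure" where
  "angle_measure \<equiv> restrict_space lborel {0..2 * pi}"

lemma finite_measure_angle_measure: "finite_measure angle_measure"
  by (rule finite_measureI) (simp add: emeasure_restrict_space)

lemma borel_measurable_circle_cis:
  fixes f :: "complex \<Rightarrow> 'b::topological_space"
  assumes "continuous_on unit_circle f"
  shows "(\<lambda>s. f (cis s)) \<in> borel_measurable angle_measure"
proof -
  have "(\<lambda>s. f (cis s)) \<in> borel_measurable (restrict_space borel {0..2*pi})"
    by (intro borel_measurable_continuous_on_restrict continuous_on_circle_cis assms)
  then show ?thesis
    by (simp add: measurable_cong_sets[OF sets_restrict_space_cong[OF sets_lborel] refl])
qed

lemma circle_mean_eq_lebesgue_integral: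
  assumes "continuous_on unit_circle f"
  shows "circle_mean f = 1 / (2 * pi) * (LINT s|angle_measure. f (cis s))"
proof -
  have "set_integrable lborel {0..2*pi} (\<lambda>s. f (cis s))"
    by (intro borel_integrable_atLeastAtMost' continuous_on_circle_cis assms)
  from set_borel_integral_eq_integral(2)[OF this] show ?thesis
    by (simp add: circle_mean_def set_lebesgue_integral_def integral_restrict_space)
qed

lemma poisson_kernel_symmetric:
  assumes "cmod s = 1" "cmod t = 1"
  shows "poisson_kernel t (of_real r * s) = poisson_kernel s (of_real r * t)"
proof -
  have "(cmod (t - of_real r * s))\<^sup>2 = (cmod (s - of_real r * t))\<^sup>2"
  proof -
    have "(Re t)\<^sup>2 + (Im t)\<^sup>2 = 1" "(Re s)\<^sup>2 + (Im s)\<^sup>2 = 1"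
      using assms by (simp_all add: cmod_power2[symmetric])
    then have "(Im t)\<^sup>2 = 1 - (Re t)\<^sup>2" "(Im s)\<^sup>2 = 1 - (Re s)\<^sup>2" by simp_all
    then show ?thesis
      unfolding cmod_power2 by (simp add: power2_diff power_mult_distrib) (simp add: algebra_simps)
  qed
  then show ?thesis using assms by (simp add: poisson_kernel_def norm_mult)
qed

lemma continuous_on_poisson_integral:
  assumes "circle_measure \<sigma>"
  shows "continuous_on unit_disk (poisson_integral \<sigma>)"
proof -
  have "continuous_on unit_disk (\<lambda>z. - ln (cmod (singular_inner 1 \<sigma> z)))"
    using holomorphic_on_imp_continuous_on[OF holomorphic_on_singular_inner[OF assms, of 1]]
    by (intro continuous_intros) (auto simp: singular_inner_def)
  then show ?thesis
    by (rule continuous_on_cong[THEN iffD1, rotated 2]) (simp_all add: norm_singular_inner[OF assms])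
qed

text \<open>Fubini, with the symmetry of the kernel in its two boundary arguments.\<close>

lemma circle_mean_poisson_integral_swap:
  assumes \<sigma>: "circle_measure \<sigma>" and \<eta>: "continuous_on unit_circle \<eta>" and r: "0 \<le> r" "r < 1"
  shows "circle_mean (\<lambda>\<zeta>. \<eta> \<zeta> * poisson_integral \<sigma> (of_real r * \<zeta>))
    = (LINT t|\<sigma>. circle_mean (\<lambda>\<zeta>. \<eta> \<zeta> * poisson_kernel \<zeta> (of_real r * t)))"
proof -
  interpret \<sigma>: finite_measure \<sigma> using \<sigma> by (simp add: circle_measure_def)
  interpret m: finite_measure angle_measure by (rule finite_measure_angle_measure)
  interpret pair_sigma_finite angle_measure \<sigma> by unfold_locales
  interpret P: finite_measure "angle_measure \<Otimes>\<^sub>M \<sigma>"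
    by (rule finite_measure_pair_measure) unfold_locales
  define F where "F = (\<lambda>s t. \<eta> (cis s) * poisson_kernel t (of_real r * cis s))"
  have w: "cmod (of_real r * \<zeta>) < 1" if "cmod \<zeta> = 1" for \<zeta>
    using that r by (simp add: norm_mult)
  obtain B where B: "\<And>t. cmod t = 1 \<Longrightarrow> norm (\<eta> t) \<le> B"
    using continuous_on_circle_bounded[OF \<eta>] by blast
  have "integrable (angle_measure \<Otimes>\<^sub>M \<sigma>) (\<lambda>(s, t). F s t)"
  proof (rule P.integrable_const_bound)
    show "AE x in angle_measure \<Otimes>\<^sub>M \<sigma>. norm (case x of (s, t) \<Rightarrow> F s t) \<le> B * ((1 + r) / (1 - r))"
    proof (rule AE_I2)
      fix x assume "x \<in> space (angle_measure \<Otimes>\<^sub>M \<sigma>)"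
      then have t: "cmod (snd x) = 1" using circle_measure_space[OF \<sigma>] by (auto simp: space_pair_measure)
      have w1: "cmod (of_real r * cis (fst x)) < 1" by (rule w) simp
      have "\<bar>\<eta> (cis (fst x))\<bar> \<le> B" using B[of "cis (fst x)"] by simp
      moreover have "\<bar>poisson_kernel (snd x) (of_real r * cis (fst x))\<bar> \<le> (1 + r) / (1 - r)"
        using poisson_kernel_le[OF t w1] poisson_kernel_nonneg[OF w1, of "snd x"] r by (simp add: norm_mult)
      ultimately show "norm (case x of (s, t) \<Rightarrow> F s t) \<le> B * ((1 + r) / (1 - r))"
        unfolding F_def case_prod_unfold real_norm_def abs_mult
        by (intro mult_mono) (auto intro: order_trans[OF abs_ge_zero])
    qed
    have c: "(\<lambda>x. \<eta> (cis (fst x))) \<in> borel_measurable (angle_measure \<Otimes>\<^sub>M \<sigma>)"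
      "(\<lambda>x. cis (fst x)) \<in> borel_measurable (angle_measure \<Otimes>\<^sub>M \<sigma>)"
      using borel_measurable_circle_cis[OF \<eta>] borel_measurable_circle_cis[OF continuous_on_id]
      by (auto intro: measurable_compose[OF measurable_fst])
    have "(\<lambda>t. t) \<in> borel_measurable \<sigma>"
      unfolding circle_measure_measurable_cong[OF \<sigma>] by (rule borel_measurable_circle) simp
    then have t: "(\<lambda>x. snd x) \<in> borel_measurable (angle_measure \<Otimes>\<^sub>M \<sigma>)"
      by (rule measurable_compose[OF measurable_snd])
    note [measurable] = c t
    show "(\<lambda>(s, t). F s t) \<in> borel_measurable (angle_measure \<Otimes>\<^sub>M \<sigma>)"
      unfolding F_def case_prod_unfold poisson_kernel_def by measurable
  qed
  from Fubini_integral[OF this]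
  have sw: "(LINT t|\<sigma>. LINT s|angle_measure. F s t) = (LINT s|angle_measure. LINT t|\<sigma>. F s t)" .
  have "continuous_on unit_circle (\<lambda>\<zeta>. \<eta> \<zeta> * poisson_integral \<sigma> (of_real r * \<zeta>))"
    by (intro continuous_on_mult \<eta> continuous_on_compose2[OF continuous_on_poisson_integral[OF \<sigma>]])
       (auto intro!: continuous_intros simp: w)
  from circle_mean_eq_lebesgue_integral[OF this]
  have "circle_mean (\<lambda>\<zeta>. \<eta> \<zeta> * poisson_integral \<sigma> (of_real r * \<zeta>))
      = 1 / (2 * pi) * (LINT s|angle_measure. LINT t|\<sigma>. F s t)"
    by (simp add: F_def poisson_integral_def)
  also have "\<dots> = (LINT t|\<sigma>. 1 / (2 * pi) * (LINT s|angle_measure. F s t))"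
    unfolding sw[symmetric] by simp
  also have "\<dots> = (LINT t|\<sigma>. circle_mean (\<lambda>\<zeta>. \<eta> \<zeta> * poisson_kernel \<zeta> (of_real r * t)))"
  proof (rule circle_integral_cong[OF \<sigma>])
    fix t :: complex assume t: "cmod t = 1"
    have "continuous_on unit_circle (\<lambda>\<zeta>. \<eta> \<zeta> * poisson_kernel \<zeta> (of_real r * t))"
      by (intro continuous_on_mult \<eta> continuous_on_poisson_kernel_circle w t)
    from circle_mean_eq_lebesgue_integral[OF this]
    show "1 / (2 * pi) * (LINT s|angle_measure. F s t)
        = circle_mean (\<lambda>\<zeta>. \<eta> \<zeta> * poisson_kernel \<zeta> (of_real r * t))"
      by (simp add: F_def poisson_kernel_symmetric[OF _ t])
  qed
  finally show ?thesis .
qed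

text \<open>The mean of \<open>\<eta>\<close> times \<open>u = P[\<sigma>] - P[\<tau>]\<close> over the circle of radius \<open>r\<close> tends to \<open>\<integral>\<eta> d\<sigma> - \<integral>\<eta> d\<tau>\<close> as \<open>r\<close> tends
  to one.  It is controlled by the elementary inequality \<open>u \<le> (exp (- a) * exp (p * u) + a) / p\<close>, in which
  \<open>exp (p * u) = cmod g powr p\<close> has bounded means.  The free parameter \<open>a\<close> expresses the uniform integrability
  of the positive part of \<open>u\<close>: a large \<open>a\<close> makes the term with \<open>M\<close> small, at the price of a large multiple of the
  Lebesgue mean of \<open>\<eta>\<close>.\<close>

lemma circle_measure_test_inequality:
  assumes p: "0 < p" and g: "g holomorphic_on unit_disk"
    and M: "\<And>r. 0 \<le> r \<Longrightarrow> r < 1 \<Longrightarrow> circle_mean (\<lambda>t. cmod (g (of_real r * t)) powr p) \<le> M"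
    and \<sigma>: "circle_measure \<sigma>" and \<tau>: "circle_measure \<tau>"
    and gnorm: "\<And>z. cmod z < 1 \<Longrightarrow> cmod (g z) = exp (poisson_integral \<sigma> z - poisson_integral \<tau> z)"
    and \<eta>: "\<And>x y. cmod x = 1 \<Longrightarrow> cmod y = 1 \<Longrightarrow> \<bar>\<eta> x - \<eta> y\<bar> \<le> L * cmod (x - y)"
    and cont: "continuous_on unit_circle \<eta>" and L: "0 \<le> L" and \<eta>01: "\<And>x. 0 \<le> \<eta> x" "\<And>x. \<eta> x \<le> 1"
    and a: "0 \<le> a"
  shows "(LINT t|\<sigma>. \<eta> t) \<le> (LINT t|\<tau>. \<eta> t) + exp (- a) * M / p + a / p * circle_mean \<eta>"
proof -
  define S where "S = measure \<sigma> unit_circle + measure \<tau> unit_circle"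
  have main: "(LINT t|\<sigma>. \<eta> t) \<le> (LINT t|\<tau>. \<eta> t) + exp (- a) * M / p + a / p * circle_mean \<eta>
      + 3 / 2 * L * sqrt (1 - r) * S" if r: "0 \<le> r" "r < 1" for r
  proof -
    define X where "X = (\<lambda>t. circle_mean (\<lambda>\<zeta>. \<eta> \<zeta> * poisson_kernel \<zeta> (of_real r * t)))"
    define c where "c = 3 / 2 * L * sqrt (1 - r)"
    have X\<eta>: "X t - c \<le> \<eta> t" "\<eta> t - c \<le> X t" if "cmod t = 1" for t
      using circle_mean_poisson_lipschitz[OF \<eta> cont L that r] unfolding X_def c_def by linarith+
    have "continuous_on (unit_circle \<times> unit_circle) (\<lambda>(t, \<zeta>). \<eta> \<zeta> * poisson_kernel \<zeta> (of_real r * t))"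
      unfolding case_prod_unfold
      by (intro continuous_on_mult continuous_on_poisson_kernel_dilation r continuous_on_compose2[OF cont] continuous_on_snd)
         (auto intro: continuous_intros)
    then have Xc: "continuous_on unit_circle X" unfolding X_def by (rule continuous_on_circle_mean)
    have c_int: "(LINT t|m. X t - c) = (LINT t|m. X t) - c * measure m unit_circle"
         "(LINT t|m. \<eta> t - c) = (LINT t|m. \<eta> t) - c * measure m unit_circle" if m: "circle_measure m" for m
    proof -
      interpret finite_measure m using m by (simp add: circle_measure_def)
      show "(LINT t|m. X t - c) = (LINT t|m. X t) - c * measure m unit_circle"
         "(LINT t|m. \<eta> t - c) = (LINT t|m. \<eta> t) - c * measure m unit_circle"
        using integrable_circle_continuous[OF m Xc] integrable_circle_continuous[OF m cont]
        by (simp_all add: circle_measure_space[OF m])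
    qed
    have mono: "integral\<^sup>L m f \<le> integral\<^sup>L m h"
      if m: "circle_measure m" and "continuous_on unit_circle f" "continuous_on unit_circle h"
        and "\<And>t. cmod t = 1 \<Longrightarrow> f t \<le> h t" for m and f h :: "complex \<Rightarrow> real"
      using that by (intro integral_mono integrable_circle_continuous) (auto simp: circle_measure_space)
    have 1: "(LINT t|\<sigma>. \<eta> t) - c * measure \<sigma> unit_circle \<le> (LINT t|\<sigma>. X t)"
      unfolding c_int(2)[OF \<sigma>, symmetric] by (rule mono[OF \<sigma>]) (intro continuous_intros cont Xc | simp add: X\<eta>)+
    have 2: "(LINT t|\<tau>. X t) - c * measure \<tau> unit_circle \<le> (LINT t|\<tau>. \<eta> t)"
      unfolding c_int(1)[OF \<tau>, symmetric] by (rule mono[OF \<tau>]) (intro continuous_intros cont Xc | simp add: X\<eta>)+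
    have pc: "continuous_on unit_circle (\<lambda>\<zeta>. poisson_integral m (of_real r * \<zeta>))" if "circle_measure m" for m
      by (rule continuous_on_compose2[OF continuous_on_poisson_integral[OF that]])
         (use r in \<open>auto intro!: continuous_intros simp: norm_mult\<close>)
    have gc: "continuous_on unit_circle (\<lambda>\<zeta>. cmod (g (of_real r * \<zeta>)) powr p)"
      by (intro continuous_on_norm_powr p continuous_on_compose2[OF holomorphic_on_imp_continuous_on[OF g]])
         (use r in \<open>auto intro!: continuous_intros simp: norm_mult\<close>)
    have "(LINT t|\<sigma>. X t) - (LINT t|\<tau>. X t)
        = circle_mean (\<lambda>\<zeta>. \<eta> \<zeta> * poisson_integral \<sigma> (of_real r * \<zeta>))
          - circle_mean (\<lambda>\<zeta>. \<eta> \<zeta> * poisson_integral \<tau> (of_real r * \<zeta>))"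
      unfolding X_def by (simp only: circle_mean_poisson_integral_swap[OF _ cont r] \<sigma> \<tau>)
    also have "\<dots> = circle_mean (\<lambda>\<zeta>. \<eta> \<zeta> * poisson_integral \<sigma> (of_real r * \<zeta>) - \<eta> \<zeta> * poisson_integral \<tau> (of_real r * \<zeta>))"
      by (rule circle_mean_diff[symmetric]) (intro continuous_on_mult cont pc \<sigma> \<tau>)+
    also have "\<dots> \<le> circle_mean (\<lambda>\<zeta>. exp (- a) / p * cmod (g (of_real r * \<zeta>)) powr p + a / p * \<eta> \<zeta>)"
    proof (rule circle_mean_mono)
      fix \<zeta> :: complex assume z: "cmod \<zeta> = 1"
      define u where "u = poisson_integral \<sigma> (of_real r * \<zeta>) - poisson_integral \<tau> (of_real r * \<zeta>)"
      have "cmod (of_real r * \<zeta>) < 1" using z r by (simp add: norm_mult)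
      then have gu: "cmod (g (of_real r * \<zeta>)) powr p = exp (p * u)"
        using gnorm by (simp add: u_def powr_def mult.commute)
      have "p * u - a \<le> exp (p * u - a)" using exp_ge_add_one_self[of "p * u - a"] by linarith
      then have "u \<le> exp (- a) / p * exp (p * u) + a / p"
        using p by (simp add: field_simps exp_diff exp_minus)
      then have "\<eta> \<zeta> * u \<le> \<eta> \<zeta> * (exp (- a) / p * exp (p * u) + a / p)"
        by (rule mult_left_mono) (rule \<eta>01)
      also have "\<dots> = \<eta> \<zeta> * (exp (- a) / p * exp (p * u)) + a / p * \<eta> \<zeta>"
        by (simp only: distrib_left mult.commute)
      also have "\<eta> \<zeta> * (exp (- a) / p * exp (p * u)) \<le> exp (- a) / p * exp (p * u)"
        using \<eta>01 p by (intro mult_left_le_one_le) auto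
      finally show "\<eta> \<zeta> * poisson_integral \<sigma> (of_real r * \<zeta>) - \<eta> \<zeta> * poisson_integral \<tau> (of_real r * \<zeta>)
          \<le> exp (- a) / p * cmod (g (of_real r * \<zeta>)) powr p + a / p * \<eta> \<zeta>"
        unfolding gu by (simp add: u_def right_diff_distrib)
    qed (intro continuous_on_diff continuous_on_add continuous_on_mult continuous_on_const cont pc gc \<sigma> \<tau>)+
    also have "\<dots> = exp (- a) / p * circle_mean (\<lambda>\<zeta>. cmod (g (of_real r * \<zeta>)) powr p) + a / p * circle_mean \<eta>"
      unfolding circle_mean_cmult[symmetric]
      by (rule circle_mean_add) (intro continuous_on_mult continuous_on_const cont gc)+
    also have "\<dots> \<le> exp (- a) / p * M + a / p * circle_mean \<eta>"
      using M[OF r] p by (intro add_right_mono mult_left_mono) auto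
    also have "exp (- a) / p * M = exp (- a) * M / p" by simp
    finally have "(LINT t|\<sigma>. X t) - (LINT t|\<tau>. X t) \<le> exp (- a) * M / p + a / p * circle_mean \<eta>" .
    moreover have "3 / 2 * L * sqrt (1 - r) * S = c * measure \<sigma> unit_circle + c * measure \<tau> unit_circle"
      by (simp only: c_def S_def distrib_left)
    ultimately show ?thesis using 1 2 by linarith
  qed
  \<comment> \<open>Letting \<open>r\<close> tend to one along \<open>1 - 1 / (n + 1)\<^sup>2\<close>, where the square root is \<open>1 / (n + 1)\<close>.\<close>
  have "(\<lambda>n. (LINT t|\<tau>. \<eta> t) + exp (- a) * M / p + a / p * circle_mean \<eta>
      + 3 / 2 * L * inverse (real (Suc n)) * S)
    \<longlonglongrightarrow> (LINT t|\<tau>. \<eta> t) + exp (- a) * M / p + a / p * circle_mean \<eta> + 3 / 2 * L * 0 * S"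
    by (intro tendsto_intros LIMSEQ_inverse_real_of_nat)
  moreover have "(LINT t|\<sigma>. \<eta> t) \<le> (LINT t|\<tau>. \<eta> t) + exp (- a) * M / p + a / p * circle_mean \<eta>
      + 3 / 2 * L * inverse (real (Suc n)) * S" for n
    using main[of "1 - (inverse (real (Suc n)))\<^sup>2"]
    by (simp add: power_le_one inverse_le_1_iff)
  ultimately show ?thesis
    using LIMSEQ_le_const[of _ _ "LINT t|\<sigma>. \<eta> t"] by simp
qed

lemma infdist_bump_tendsto_indicator:
  assumes "closed K" "K \<noteq> {}"
  shows "(\<lambda>n. max 0 (1 - real n * infdist x K)) \<longlonglongrightarrow> indicator K x"
proof (cases "x \<in> K")
  case True
  then show ?thesis by simp
next
  case False
  then have d: "0 < infdist x K"
    using assms by (simp add: infdist_pos_not_in_closed)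
  then obtain N :: nat where N: "1 < real N * infdist x K" using reals_Archimedean3 by blast
  have "max 0 (1 - real n * infdist x K) = 0" if "N \<le> n" for n
  proof -
    have "real N * infdist x K \<le> real n * infdist x K" using that d by (intro mult_right_mono) auto
    then show ?thesis using N by simp
  qed
  then have "\<forall>\<^sub>F n in sequentially. max 0 (1 - real n * infdist x K) = 0"
    unfolding eventually_sequentially by blast
  then show ?thesis using False by (simp add: tendsto_eventually)
qed

text \<open>Lipschitz bumps decreasing to the indicator of \<open>K\<close> make the Lebesgue term of the test inequality
  vanish for each fixed \<open>a\<close>; only then does \<open>a\<close> tend to infinity.\<close>

lemma emeasure_compact_null_le:
  assumes p: "0 < p" and g: "g holomorphic_on unit_disk"
    and M: "\<And>r. 0 \<le> r \<Longrightarrow> r < 1 \<Longrightarrow> circle_mean (\<lambda>t. cmod (g (of_real r * t)) powr p) \<le> M"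
    and \<sigma>: "circle_measure \<sigma>" and \<tau>: "circle_measure \<tau>"
    and gnorm: "\<And>z. cmod z < 1 \<Longrightarrow> cmod (g z) = exp (poisson_integral \<sigma> z - poisson_integral \<tau> z)"
    and K: "compact K" "K \<subseteq> unit_circle" and null: "AE s in angle_measure. cis s \<notin> K"
  shows "emeasure \<sigma> K \<le> emeasure \<tau> K"
proof (cases "K = {}")
  case True
  then show ?thesis by simp
next
  case False
  have cl: "closed K" using K(1) by (rule compact_imp_closed)
  define \<eta> where "\<eta> = (\<lambda>n x. max 0 (1 - real n * infdist x K))"
  have lip: "\<bar>\<eta> n x - \<eta> n y\<bar> \<le> real n * cmod (x - y)" for n x y
  proof -
    have "\<bar>\<eta> n x - \<eta> n y\<bar> \<le> \<bar>real n * infdist x K - real n * infdist y K\<bar>"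
      unfolding \<eta>_def by linarith
    also have "\<dots> = real n * \<bar>infdist x K - infdist y K\<bar>"
      by (simp add: right_diff_distrib[symmetric] abs_mult)
    also have "\<dots> \<le> real n * cmod (x - y)"
      using infdist_triangle_abs[of x K y] by (intro mult_left_mono) (auto simp: dist_norm)
    finally show ?thesis .
  qed
  have cont: "continuous_on A (\<eta> n)" for A n
    unfolding \<eta>_def by (intro continuous_intros)
  have \<eta>01: "0 \<le> \<eta> n x" "\<eta> n x \<le> 1" for n x
    unfolding \<eta>_def by (auto simp: infdist_nonneg)
  have lim: "(\<lambda>n. \<eta> n x) \<longlonglongrightarrow> indicator K x" for x
    unfolding \<eta>_def by (rule infdist_bump_tendsto_indicator[OF cl False])
  have Kb: "K \<in> sets circle_borel"
    using cl K(2) by (simp add: circle_borel_def sets_restrict_space_iff)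
  have lim_int: "(\<lambda>n. LINT t|m. \<eta> n t) \<longlonglongrightarrow> measure m K" if m: "circle_measure m" for m
  proof -
    interpret finite_measure m using m by (simp add: circle_measure_def)
    have Km: "K \<in> sets m" using Kb m by (simp add: circle_measure_def)
    have "(\<lambda>n. LINT t|m. \<eta> n t) \<longlonglongrightarrow> (LINT t|m. indicator K t)"
    proof (rule integral_dominated_convergence)
      show "integrable m (\<lambda>_. 1 :: real)" by simp
      show "indicator K \<in> borel_measurable m" using Km by simp
      show "\<eta> n \<in> borel_measurable m" for n
        unfolding circle_measure_measurable_cong[OF m] by (intro borel_measurable_circle_continuous cont)
    qed (use \<eta>01 lim in auto)
    then show ?thesis using Km by simp
  qed
  have lim_mean: "(\<lambda>n. circle_mean (\<eta> n)) \<longlonglongrightarrow> 0"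
  proof -
    interpret finite_measure angle_measure by (rule finite_measure_angle_measure)
    have "(\<lambda>n. LINT s|angle_measure. \<eta> n (cis s)) \<longlonglongrightarrow> (LINT s|angle_measure. 0)"
    proof (rule integral_dominated_convergence)
      show "integrable angle_measure (\<lambda>_. 1 :: real)" by simp
      show "(\<lambda>s. \<eta> n (cis s)) \<in> borel_measurable angle_measure" for n
        by (intro borel_measurable_circle_cis cont)
      show "AE s in angle_measure. (\<lambda>n. \<eta> n (cis s)) \<longlonglongrightarrow> 0"
        using null
      proof eventually_elim
        case (elim s)
        then show ?case using lim[of "cis s"] by simp
      qed
    qed (use \<eta>01 in auto)
    then have "(\<lambda>n. 1 / (2 * pi) * (LINT s|angle_measure. \<eta> n (cis s))) \<longlonglongrightarrow> 1 / (2 * pi) * 0"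
      by (intro tendsto_mult_left) simp
    then show ?thesis by (simp add: circle_mean_eq_lebesgue_integral[OF cont])
  qed
  have step: "measure \<sigma> K \<le> measure \<tau> K + exp (- a) * M / p" if a: "0 \<le> a" for a
  proof (rule LIMSEQ_le[OF lim_int[OF \<sigma>]])
    show "(\<lambda>n. (LINT t|\<tau>. \<eta> n t) + exp (- a) * M / p + a / p * circle_mean (\<eta> n))
        \<longlonglongrightarrow> measure \<tau> K + exp (- a) * M / p"
      using tendsto_add[OF tendsto_add[OF lim_int[OF \<tau>] tendsto_const[of "exp (- a) * M / p"]]
        tendsto_mult_left[OF lim_mean, of "a / p"]] by simp
    show "\<exists>N. \<forall>n\<ge>N. (LINT t|\<sigma>. \<eta> n t) \<le> (LINT t|\<tau>. \<eta> n t) + exp (- a) * M / p + a / p * circle_mean (\<eta> n)"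
      using circle_measure_test_inequality[OF p g M \<sigma> \<tau> gnorm lip cont of_nat_0_le_iff \<eta>01 a] by blast
  qed
  have "(\<lambda>n. exp (- real n)) \<longlonglongrightarrow> 0"
    by real_asymp
  then have "(\<lambda>n. measure \<tau> K + exp (- real n) * M / p) \<longlonglongrightarrow> measure \<tau> K + 0 * M / p"
    by (intro tendsto_intros) (use p in auto)
  then have "measure \<sigma> K \<le> measure \<tau> K + 0 * M / p"
    by (rule LIMSEQ_le_const) (use step in auto)
  then show ?thesis
    using \<sigma> \<tau> by (simp add: circle_measure_def finite_measure.emeasure_eq_measure ennreal_leI)
qed

text \<open>By inner regularity only compact subsets of the Lebesgue null set that carries \<open>\<sigma>\<close> matter.\<close>

lemma singular_measure_le:
  assumes p: "0 < p" and g: "g \<in> hardy_space p"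
    and \<sigma>: "finite_singular_measure \<sigma>" and \<tau>: "circle_measure \<tau>"
    and gnorm: "\<And>z. cmod z < 1 \<Longrightarrow> cmod (g z) = exp (poisson_integral \<sigma> z - poisson_integral \<tau> z)"
    and E: "E \<in> sets circle_borel"
  shows "emeasure \<sigma> E \<le> emeasure \<tau> E"
proof -
  have \<sigma>c: "circle_measure \<sigma>" using \<sigma> by (simp add: finite_singular_measure_def circle_measure_def)
  have s\<sigma>: "sets \<sigma> = sets circle_borel" and s\<tau>: "sets \<tau> = sets circle_borel"
    using \<sigma>c \<tau> by (simp_all add: circle_measure_def)
  obtain M where gh: "g holomorphic_on unit_disk"
    and M: "\<And>r. 0 \<le> r \<Longrightarrow> r < 1 \<Longrightarrow> circle_mean (\<lambda>t. cmod (g (of_real r * t)) powr p) \<le> M"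
    using hardy_spaceE[OF g] by blast
  obtain A where A: "A \<in> sets circle_borel" and A0: "emeasure \<sigma> (unit_circle - A) = 0"
    and LA: "emeasure circle_lebesgue A = 0"
    using \<sigma> circle_measure_space[OF \<sigma>c]
    unfolding finite_singular_measure_def mutually_singular_def by (auto simp: s\<sigma>)
  have null: "AE s in angle_measure. cis s \<notin> A"
  proof -
    let ?N = "cis -` A \<inter> {0..<2*pi}"
    have "cis \<in> borel_measurable borel" by (intro borel_measurable_continuous_onI continuous_intros)
    then have cm: "cis \<in> measurable (restrict_space lborel {0..<2*pi}) circle_borel"
      unfolding circle_borel_def by (intro measurable_restrict_space3) auto
    have "?N \<in> sets (restrict_space lborel {0..<2*pi})"
      using measurable_sets[OF cm A] by (simp add: space_restrict_space)
    then have N: "?N \<in> sets lborel" by (subst (asm) sets_restrict_space_iff) auto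
    have "emeasure lborel ?N = 0"
      using LA A cm by (simp add: circle_lebesgue_def emeasure_distr emeasure_restrict_space space_restrict_space)
    then have "AE s in lborel. s \<notin> ?N"
      using N by (intro AE_not_in) (simp add: null_sets_def)
    \<comment> \<open>The angles of \<open>circle_lebesgue\<close> form a half-open interval, those of \<open>angle_measure\<close> a closed one.\<close>
    moreover have "AE s in lborel. s \<noteq> 2 * pi" by (rule AE_lborel_singleton)
    ultimately have "AE s in lborel. s \<in> {0..2*pi} \<longrightarrow> cis s \<notin> A"
      by eventually_elim auto
    then show ?thesis by (subst AE_restrict_space_iff) auto
  qed
  define D where "D = distr \<sigma> borel (\<lambda>x. x)"
  have idm: "(\<lambda>x. x) \<in> measurable \<sigma> borel"
    unfolding circle_measure_measurable_cong[OF \<sigma>c] by (rule borel_measurable_circle) simp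
  have D: "emeasure D B = emeasure \<sigma> B" if "B \<in> sets borel" "B \<subseteq> unit_circle" for B
    unfolding D_def using that circle_measure_space[OF \<sigma>c]
    by (subst emeasure_distr[OF idm]) (auto intro!: arg_cong[where f="emeasure \<sigma>"])
  have "E \<inter> A \<in> sets circle_borel" using E A by blast
  then have EA: "E \<inter> A \<in> sets borel" "E \<inter> A \<subseteq> unit_circle"
    by (simp_all add: circle_borel_def sets_restrict_space_iff)
  have "emeasure D (E \<inter> A) = (SUP K \<in> {K. K \<subseteq> E \<inter> A \<and> compact K}. emeasure D K)"
  proof (rule inner_regular)
    show "sets D = sets borel" by (simp add: D_def)
    interpret finite_measure D
      unfolding D_def by (rule finite_measure.finite_measure_distr[OF _ idm]) (use \<sigma>c in \<open>simp add: circle_measure_def\<close>)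
    show "emeasure D (space D) \<noteq> \<infinity>" by simp
  qed (use EA in simp)
  also have "\<dots> \<le> emeasure \<tau> E"
  proof (rule SUP_least)
    fix K assume "K \<in> {K. K \<subseteq> E \<inter> A \<and> compact K}"
    then have K: "K \<subseteq> E" "K \<subseteq> A" "compact K" "K \<subseteq> unit_circle" using EA by auto
    have nullK: "AE s in angle_measure. cis s \<notin> K" using null by eventually_elim (use K(2) in auto)
    have "emeasure \<sigma> K \<le> emeasure \<tau> K"
      by (rule emeasure_compact_null_le[OF p gh _ \<sigma>c \<tau> _ K(3,4) nullK]) (fact M, fact gnorm)
    also have "\<dots> \<le> emeasure \<tau> E" using K(1) E s\<tau> by (intro emeasure_mono) auto
    finally show "emeasure D K \<le> emeasure \<tau> E"
      using D[OF borel_closed[OF compact_imp_closed[OF K(3)]] K(4)] by simp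
  qed
  finally have "emeasure \<sigma> (E \<inter> A) \<le> emeasure \<tau> E" using D EA by simp
  moreover have "emeasure \<sigma> (E - A) = 0"
  proof -
    have "emeasure \<sigma> (E - A) \<le> emeasure \<sigma> (unit_circle - A)"
      using sets_circle_borel_subset[OF E] A sets.top[of \<sigma>] s\<sigma> circle_measure_space[OF \<sigma>c]
      by (intro emeasure_mono) (auto intro: sets.Diff)
    then show ?thesis using A0 by simp
  qed
  moreover have "emeasure \<sigma> E = emeasure \<sigma> (E \<inter> A) + emeasure \<sigma> (E - A)"
  proof -
    have "E = (E \<inter> A) \<union> (E - A)" "(E \<inter> A) \<inter> (E - A) = {}" by blast+
    then show ?thesis using plus_emeasure[of "E \<inter> A" \<sigma> "E - A"] E A s\<sigma> by simp
  qed
  ultimately show ?thesis by simp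
qed

section \<open>Images of the spaces generated by singular inner functions\<close>

lemma hardy_space_mult_bounded:
  assumes p: "0 < p" and h: "h \<in> hardy_space p" and q: "q holomorphic_on unit_disk"
    and le: "\<And>z. cmod z < 1 \<Longrightarrow> cmod (q z) \<le> 1"
  shows "(\<lambda>z\<in>unit_disk. q z * h z) \<in> hardy_space p"
proof -
  obtain M where hh: "h holomorphic_on unit_disk"
    and M: "\<And>r. 0 \<le> r \<Longrightarrow> r < 1 \<Longrightarrow> circle_mean (\<lambda>t. cmod (h (of_real r * t)) powr p) \<le> M"
    using hardy_spaceE[OF h] by blast
  show ?thesis
  proof (rule hardy_spaceI)
    have qh: "(\<lambda>z. q z * h z) holomorphic_on unit_disk" using q hh by (rule holomorphic_on_mult)
    then show "(\<lambda>z\<in>unit_disk. q z * h z) holomorphic_on unit_disk"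
      by (rule holomorphic_transform) simp
    fix r :: real assume r: "0 \<le> r" "r < 1"
    have w: "cmod (of_real r * t) < 1" if "cmod t = 1" for t
      using that r by (simp add: norm_mult)
    have cont: "continuous_on unit_circle (\<lambda>t. cmod (f (of_real r * t)) powr p)"
      if "f holomorphic_on unit_disk" for f
      by (intro continuous_on_norm_powr p continuous_on_compose2[OF holomorphic_on_imp_continuous_on[OF that]])
         (use w in \<open>auto intro!: continuous_intros\<close>)
    have "circle_mean (\<lambda>t. cmod ((\<lambda>z\<in>unit_disk. q z * h z) (of_real r * t)) powr p)
        = circle_mean (\<lambda>t. cmod (q (of_real r * t) * h (of_real r * t)) powr p)"
      using w by (intro circle_mean_cong) simp
    also have "\<dots> \<le> circle_mean (\<lambda>t. cmod (h (of_real r * t)) powr p)"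
    proof (rule circle_mean_mono[OF cont[OF qh] cont[OF hh]])
      fix t :: complex assume "cmod t = 1"
      then have "cmod (q (of_real r * t) * h (of_real r * t)) \<le> cmod (h (of_real r * t))"
        using le[OF w] by (simp add: norm_mult mult_left_le_one_le)
      then show "cmod (q (of_real r * t) * h (of_real r * t)) powr p \<le> cmod (h (of_real r * t)) powr p"
        using p by (intro powr_mono2) auto
    qed
    also have "\<dots> \<le> M" by (rule M[OF r])
    finally show "circle_mean (\<lambda>t. cmod ((\<lambda>z\<in>unit_disk. q z * h z) (of_real r * t)) powr p) \<le> M" .
  qed simp
qed

lemma one_in_hardy_space: "(\<lambda>z\<in>unit_disk. 1) \<in> hardy_space p"
proof (rule hardy_spaceI[where M = 1])
  have "(\<lambda>z. 1) holomorphic_on unit_disk" by simp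
  then show "(\<lambda>z\<in>unit_disk. 1) holomorphic_on unit_disk"
    by (rule holomorphic_transform) simp
  fix r :: real assume "0 \<le> r" "r < 1"
  then have "circle_mean (\<lambda>t. cmod ((\<lambda>z\<in>unit_disk. 1) (of_real r * t)) powr p) = circle_mean (\<lambda>t. 1)"
    by (intro circle_mean_cong) (simp add: norm_mult)
  then show "circle_mean (\<lambda>t. cmod ((\<lambda>z\<in>unit_disk. 1) (of_real r * t)) powr p) \<le> 1" by simp
qed simp

lemma poisson_integral_mono:
  assumes \<sigma>: "circle_measure \<sigma>" and \<tau>: "circle_measure \<tau>" and z: "cmod z < 1"
    and le: "\<And>E. E \<in> sets circle_borel \<Longrightarrow> emeasure \<sigma> E \<le> emeasure \<tau> E"
  shows "poisson_integral \<sigma> z \<le> poisson_integral \<tau> z"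
proof -
  have s: "sets \<sigma> = sets \<tau>" using \<sigma> \<tau> by (simp add: circle_measure_def)
  have m: "\<sigma> \<le> \<tau>" using circle_measure_leI[OF \<sigma> \<tau>] le by blast
  have int: "integrable m (\<lambda>t. poisson_kernel t z)" if "circle_measure m" for m
    by (rule integrable_circle_continuous[OF that continuous_on_poisson_kernel_circle[OF z]])
  have eq: "ennreal (poisson_integral m z) = (\<integral>\<^sup>+t. ennreal (poisson_kernel t z) \<partial>m)" if "circle_measure m" for m
    unfolding poisson_integral_def
    by (rule nn_integral_eq_integral[symmetric, OF int[OF that]]) (simp add: poisson_kernel_nonneg[OF z])
  have "ennreal (poisson_integral \<sigma> z) \<le> ennreal (poisson_integral \<tau> z)"
    unfolding eq[OF \<sigma>] eq[OF \<tau>] by (rule nn_integral_mono_measure[OF s m])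
  moreover have "0 \<le> poisson_integral \<tau> z"
    unfolding poisson_integral_def by (simp add: poisson_kernel_nonneg[OF z])
  ultimately show ?thesis by simp
qed

lemma times_space_cong:
  assumes "\<And>z. z \<in> unit_disk \<Longrightarrow> S z = T z"
  shows "times_space S X = times_space T X"
  unfolding times_space_def using assms by (intro image_cong refl) (auto simp: restrict_def)

lemma composition_operator_cong:
  assumes "\<And>z. z \<in> unit_disk \<Longrightarrow> \<theta> z = \<phi> z"
  shows "composition_operator \<theta> = composition_operator \<phi>"
  using assms by (intro ext) (simp add: composition_operator_def compose_def restrict_def)

text \<open>The identity witnessing membership in the second space, evaluated at \<open>B z\<close>, is the one required of the
  conjugate; the Hardy space factors on both sides move by composition with \<open>B\<close>, which keeps them in the space.\<close>

lemma composition_inclusion_conjugate: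
  assumes p: "0 < p" and B: "B holomorphic_on unit_disk" "B \<in> unit_disk \<rightarrow> unit_disk"
    and BB: "\<And>z. z \<in> unit_disk \<Longrightarrow> B (B z) = z" and \<theta>: "\<theta> \<in> unit_disk \<rightarrow> unit_disk"
    and incl: "composition_operator \<theta> ` times_space S (hardy_space p) \<subseteq> times_space T (hardy_space p)"
  shows "composition_operator (B \<circ> \<theta> \<circ> B) ` times_space (S \<circ> B) (hardy_space p)
    \<subseteq> times_space (T \<circ> B) (hardy_space p)"
proof (clarsimp simp: times_space_def)
  fix f assume f: "f \<in> hardy_space p"
  note CB = hardy_space_compose[OF p _ B]
  have "composition_operator \<theta> (\<lambda>z\<in>unit_disk. S z * composition_operator B f z) \<in> times_space T (hardy_space p)"
    using incl CB[OF f] unfolding times_space_def by blast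
  then obtain g where g: "g \<in> hardy_space p"
    and eq: "composition_operator \<theta> (\<lambda>z\<in>unit_disk. S z * composition_operator B f z) = (\<lambda>z\<in>unit_disk. T z * g z)"
    unfolding times_space_def by blast
  have "composition_operator (B \<circ> \<theta> \<circ> B) (\<lambda>z\<in>unit_disk. S (B z) * f z)
      = (\<lambda>z\<in>unit_disk. T (B z) * composition_operator B g z)"
  proof
    fix z
    show "composition_operator (B \<circ> \<theta> \<circ> B) (\<lambda>z\<in>unit_disk. S (B z) * f z) z
        = (\<lambda>z\<in>unit_disk. T (B z) * composition_operator B g z) z"
    proof (cases "z \<in> unit_disk")
      case True
      then have in_disk: "B z \<in> unit_disk" "\<theta> (B z) \<in> unit_disk" "B (\<theta> (B z)) \<in> unit_disk"
        using B(2) \<theta> by blast+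
      then show ?thesis
        using True fun_cong[OF eq, of "B z"] BB[OF in_disk(2)]
        by (simp add: composition_operator_def compose_def)
    next
      case False
      then show ?thesis by (simp add: composition_operator_def compose_def)
    qed
  qed
  then show "composition_operator (B \<circ> \<theta> \<circ> B) (\<lambda>z\<in>unit_disk. S (B z) * f z)
      \<in> (\<lambda>f. \<lambda>z\<in>unit_disk. T (B z) * f z) ` hardy_space p"
    using CB[OF g] by (intro image_eqI)
qed

text \<open>The factor \<open>S (\<theta> z) / T z\<close> has modulus \<open>exp (P[\<tau>] z - P[\<sigma>] z) \<le> 1\<close>.\<close>

lemma composition_inclusion_if_measure_le:
  assumes p: "0 < p" and \<theta>: "\<theta> holomorphic_on unit_disk" "\<theta> \<in> unit_disk \<rightarrow> unit_disk"
    and S: "(\<lambda>z. S (\<theta> z)) holomorphic_on unit_disk" and T: "T holomorphic_on unit_disk"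
    and \<sigma>: "circle_measure \<sigma>" and \<tau>: "circle_measure \<tau>"
    and nS: "\<And>z. cmod z < 1 \<Longrightarrow> cmod (S (\<theta> z)) = exp (- poisson_integral \<sigma> z)"
    and nT: "\<And>z. cmod z < 1 \<Longrightarrow> cmod (T z) = exp (- poisson_integral \<tau> z)"
    and le: "\<And>E. E \<in> sets circle_borel \<Longrightarrow> emeasure \<tau> E \<le> emeasure \<sigma> E"
  shows "composition_operator \<theta> ` times_space S (hardy_space p) \<subseteq> times_space T (hardy_space p)"
proof (clarsimp simp: times_space_def)
  fix f assume f: "f \<in> hardy_space p"
  have nz: "T z \<noteq> 0" if "cmod z < 1" for z using nT[OF that] by auto
  define g where "g = (\<lambda>z\<in>unit_disk. S (\<theta> z) / T z * composition_operator \<theta> f z)"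
  have "g \<in> hardy_space p"
    unfolding g_def
  proof (rule hardy_space_mult_bounded[OF p hardy_space_compose[OF p f \<theta>]])
    show "(\<lambda>z. S (\<theta> z) / T z) holomorphic_on unit_disk"
      using nz by (intro holomorphic_on_divide S T) auto
    show "cmod (S (\<theta> z) / T z) \<le> 1" if "cmod z < 1" for z
      using poisson_integral_mono[OF \<tau> \<sigma> that le] by (simp add: norm_divide nS[OF that] nT[OF that])
  qed
  moreover have "composition_operator \<theta> (\<lambda>z\<in>unit_disk. S z * f z) = (\<lambda>z\<in>unit_disk. T z * g z)"
    using \<theta>(2) nz by (fastforce simp: g_def composition_operator_def compose_def restrict_def)
  ultimately show "composition_operator \<theta> (\<lambda>z\<in>unit_disk. S z * f z) \<in> (\<lambda>f. \<lambda>z\<in>unit_disk. T z * f z) ` hardy_space p"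
    by (intro image_eqI)
qed

text \<open>The Schwarz lemma for \<open>\<psi>\<close> and for its inverse gives \<open>cmod (\<psi> z) = cmod z\<close>, and equality at one point other
  than the origin forces a rotation.\<close>

lemma disk_automorphism_rotation:
  assumes \<psi>: "disk_automorphism \<psi>" and 0: "\<psi> 0 = 0"
  obtains c where "cmod c = 1" "\<And>z. cmod z < 1 \<Longrightarrow> \<psi> z = c * z"
proof -
  have hol: "\<psi> holomorphic_on unit_disk" and inj: "inj_on \<psi> unit_disk" and im: "\<psi> ` unit_disk = unit_disk"
    using \<psi> by (auto simp: disk_automorphism_def bij_betw_def)
  obtain g where g: "g holomorphic_on \<psi> ` unit_disk"
    and gi: "\<And>z. z \<in> unit_disk \<Longrightarrow> g (\<psi> z) = z"
    using holomorphic_has_inverse[OF hol open_ball inj] by metis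
  have g1: "cmod (g w) < 1" if "cmod w < 1" for w
  proof -
    have "w \<in> \<psi> ` unit_disk" using im that by simp
    then show ?thesis using gi by auto
  qed
  have \<psi>1: "cmod (\<psi> z) < 1" if "cmod z < 1" for z using im that by auto
  have g0: "g 0 = 0" using gi[of 0] 0 by simp
  have "cmod (g (\<psi> (1/2))) \<le> cmod (\<psi> (1/2))"
    by (rule Schwarz_Lemma(1)[where f = g, OF _ g0 g1]) (use g im \<psi>1 in auto)
  moreover have "cmod (\<psi> (1/2)) \<le> cmod (1/2)"
    by (rule Schwarz_Lemma(1)[OF hol 0 \<psi>1]) auto
  ultimately have "cmod (\<psi> (1/2)) = cmod (1/2)" using gi[of "1/2"] by simp
  then have "\<exists>z. cmod z < 1 \<and> z \<noteq> 0 \<and> cmod (\<psi> z) = cmod z"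
    by (intro exI[of _ "1/2"]) auto
  then obtain c where "\<forall>z. cmod z < 1 \<longrightarrow> \<psi> z = c * z" "cmod c = 1"
    using Schwarz_Lemma(3)[OF hol 0 \<psi>1, of 0] by auto
  then show ?thesis using that by blast
qed

lemma disk_automorphism_blaschke:
  assumes "cmod a < 1"
  shows "disk_automorphism (blaschke a)"
  unfolding disk_automorphism_def
proof
  show "bij_betw (blaschke a) unit_disk unit_disk"
    using blaschke_in_disk[OF assms] blaschke_involution[OF assms]
    by (intro bij_betwI[where g = "blaschke a"]) auto
qed (rule holomorphic_on_blaschke[OF assms])

lemma disk_automorphism_compose:
  assumes "disk_automorphism \<phi>" "disk_automorphism \<psi>"
  shows "disk_automorphism (\<psi> \<circ> \<phi>)"
  using assms unfolding disk_automorphism_def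
  by (auto intro: bij_betw_trans intro!: holomorphic_on_compose_gen dest: bij_betw_imp_surj_on)

lemma continuous_on_blaschke:
  assumes "cmod a < 1"
  shows "continuous_on (cball 0 1) (blaschke a)"
  unfolding blaschke_def[abs_def] using blaschke_denom_nonzero[OF assms]
  by (intro continuous_intros) auto

text \<open>Only the values of \<open>\<phi>\<close> in the open disk enter the boundary map, so any extension of \<open>\<phi>\<close> that is continuous
  on the closed disk computes it.\<close>

lemma boundary_map_eq:
  assumes cont: "continuous_on (cball 0 1) f" and eq: "\<And>z. cmod z < 1 \<Longrightarrow> \<phi> z = f z" and t: "cmod t = 1"
  shows "boundary_map \<phi> t = f t"
proof -
  have "(f \<longlongrightarrow> f t) (at t within cball 0 1)"
    using cont t by (simp add: continuous_on)
  then have "(f \<longlongrightarrow> f t) (at t within unit_disk)"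
    by (rule tendsto_within_subset) auto
  then have "(\<phi> \<longlongrightarrow> f t) (at t within unit_disk)"
    by (rule Lim_transform_within[OF _ zero_less_one]) (simp add: eq)
  moreover have "at t within unit_disk \<noteq> bot"
    using t by (simp add: trivial_limit_within islimpt_ball)
  ultimately show ?thesis unfolding boundary_map_def by (intro tendsto_Lim)
qed

theorem theorem4p4:
  fixes p :: real and \<phi> \<psi> :: "complex \<Rightarrow> complex" and \<omega> \<alpha>\<^sub>1 \<alpha>\<^sub>2 :: complex
    and \<mu>\<^sub>1 \<mu>\<^sub>2 \<nu>\<^sub>1 \<nu>\<^sub>2 :: "complex measure" and S\<^sub>1 S\<^sub>2 :: "complex \<Rightarrow> complex"
  assumes "0 < p"
    and "disk_automorphism \<phi>"
    and "{z \<in> unit_disk. \<phi> z = z} = {\<omega>}"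
    and "\<psi> = blaschke \<omega> \<circ> \<phi> \<circ> blaschke \<omega>"
    and "finite_singular_measure \<mu>\<^sub>1" and "cmod \<alpha>\<^sub>1 = 1" and "S\<^sub>1 = singular_inner \<alpha>\<^sub>1 \<mu>\<^sub>1"
    and "finite_singular_measure \<mu>\<^sub>2" and "cmod \<alpha>\<^sub>2 = 1" and "S\<^sub>2 = singular_inner \<alpha>\<^sub>2 \<mu>\<^sub>2"
    and "\<nu>\<^sub>1 = transported_measure \<omega> \<mu>\<^sub>1"
    and "\<nu>\<^sub>2 = transported_measure \<omega> \<mu>\<^sub>2"
  shows "(composition_operator \<phi> ` times_space S\<^sub>1 (hardy_space p)
              \<subseteq> times_space S\<^sub>2 (hardy_space p) \<longleftrightarrow>
          composition_operator \<psi> ` times_space (S\<^sub>1 \<circ> blaschke \<omega>) (hardy_space p)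
              \<subseteq> times_space (S\<^sub>2 \<circ> blaschke \<omega>) (hardy_space p)) \<and>
         (composition_operator \<psi> ` times_space (S\<^sub>1 \<circ> blaschke \<omega>) (hardy_space p)
              \<subseteq> times_space (S\<^sub>2 \<circ> blaschke \<omega>) (hardy_space p) \<longleftrightarrow>
          (\<forall>E \<in> sets circle_borel.
              emeasure \<nu>\<^sub>2 (blaschke \<omega> ` E) \<le> emeasure \<nu>\<^sub>1 (blaschke \<omega> ` (boundary_map \<phi> ` E))))"
proof -
  note p = \<open>0 < p\<close>
  have "\<omega> \<in> {z \<in> unit_disk. \<phi> z = z}" using assms(3) by simp
  then have \<omega>: "cmod \<omega> < 1" and fix_\<omega>: "\<phi> \<omega> = \<omega>" by auto
  define B where "B = blaschke \<omega>"
  have B_hol: "B holomorphic_on unit_disk" and B_map: "B \<in> unit_disk \<rightarrow> unit_disk"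
    using holomorphic_on_blaschke[OF \<omega>] blaschke_in_disk[OF \<omega>] by (auto simp: B_def)
  have B1: "cmod (B z) < 1" if "cmod z < 1" for z using blaschke_in_disk[OF \<omega> that] by (simp add: B_def)
  have BB: "B (B z) = z" if "cmod z \<le> 1" for z using blaschke_involution[OF \<omega> that] by (simp add: B_def)
  have \<phi>_hol: "\<phi> holomorphic_on unit_disk" and \<phi>_map: "\<phi> \<in> unit_disk \<rightarrow> unit_disk"
    using assms(2) by (auto simp: disk_automorphism_def bij_betw_def)
  have \<psi>_aut: "disk_automorphism \<psi>"
    unfolding assms(4) by (intro disk_automorphism_compose disk_automorphism_blaschke \<omega> assms(2))
  then have \<psi>_hol: "\<psi> holomorphic_on unit_disk" and \<psi>_map: "\<psi> \<in> unit_disk \<rightarrow> unit_disk"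
    by (auto simp: disk_automorphism_def bij_betw_def)
  have "\<psi> 0 = 0" by (simp add: assms(4) fix_\<omega>)
  from disk_automorphism_rotation[OF \<psi>_aut this]
  obtain c where c: "cmod c = 1" and \<psi>c: "\<And>z. cmod z < 1 \<Longrightarrow> \<psi> z = c * z" by blast
  have c1: "cmod (c * z) = cmod z" for z using c by (simp add: norm_mult)
  have \<phi>_eq: "\<phi> z = B (c * B z)" if z: "cmod z < 1" for z
  proof -
    have "c * B z = B (\<phi> z)"
      using \<psi>c[OF B1[OF z]] BB[of z] z by (simp add: assms(4) B_def)
    moreover have "cmod (\<phi> z) < 1" using \<phi>_map z by auto
    ultimately show ?thesis using BB[of "\<phi> z"] by simp
  qed

  have \<mu>: "circle_measure \<mu>\<^sub>1" "circle_measure \<mu>\<^sub>2"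
    using assms(5,8) by (simp_all add: finite_singular_measure_def circle_measure_def)
  have \<nu>: "circle_measure \<nu>\<^sub>1" "circle_measure \<nu>\<^sub>2"
    unfolding assms(11,12) by (intro circle_measure_transported_measure \<omega> \<mu>)+
  define \<sigma> where "\<sigma> = rotated_measure c \<nu>\<^sub>1"
  have \<sigma>: "circle_measure \<sigma>" unfolding \<sigma>_def by (rule circle_measure_rotated_measure[OF c \<nu>(1)])
  have P\<nu>: "poisson_integral \<nu>\<^sub>1 z = poisson_integral \<mu>\<^sub>1 (B z)"
    "poisson_integral \<nu>\<^sub>2 z = poisson_integral \<mu>\<^sub>2 (B z)" if "cmod z < 1" for z
    unfolding assms(11,12) B_def using poisson_integral_transported_measure[OF \<omega> _ that] \<mu> by blast+
  have P\<sigma>: "poisson_integral \<sigma> z = poisson_integral \<mu>\<^sub>1 (B (c * z))" if z: "cmod z < 1" for z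
    unfolding \<sigma>_def poisson_integral_rotated_measure[OF c \<nu>(1) z] using P\<nu>(1)[of "c * z"] z by (simp add: c1)
  have nS1: "cmod (S\<^sub>1 z) = exp (- poisson_integral \<mu>\<^sub>1 z)" and nS2: "cmod (S\<^sub>2 z) = exp (- poisson_integral \<mu>\<^sub>2 z)"
    if "cmod z < 1" for z
    using norm_singular_inner[OF \<mu>(1) that] norm_singular_inner[OF \<mu>(2) that] assms(6,7,9,10) by simp_all
  have S_hol: "S\<^sub>1 holomorphic_on unit_disk" "S\<^sub>2 holomorphic_on unit_disk"
    using holomorphic_on_singular_inner \<mu> assms(7,10) by auto

  let ?incl = "\<lambda>\<theta> S T. composition_operator \<theta> ` times_space S (hardy_space p) \<subseteq> times_space T (hardy_space p)"
  have conj: "?incl \<phi> S\<^sub>1 S\<^sub>2 \<longleftrightarrow> ?incl \<psi> (S\<^sub>1 \<circ> B) (S\<^sub>2 \<circ> B)"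
  proof
    assume "?incl \<phi> S\<^sub>1 S\<^sub>2"
    from composition_inclusion_conjugate[OF p B_hol B_map _ \<phi>_map this]
    show "?incl \<psi> (S\<^sub>1 \<circ> B) (S\<^sub>2 \<circ> B)" using BB by (simp add: assms(4) B_def)
  next
    assume "?incl \<psi> (S\<^sub>1 \<circ> B) (S\<^sub>2 \<circ> B)"
    from composition_inclusion_conjugate[OF p B_hol B_map _ \<psi>_map this]
    have "?incl (B \<circ> \<psi> \<circ> B) (S\<^sub>1 \<circ> B \<circ> B) (S\<^sub>2 \<circ> B \<circ> B)" using BB by simp
    moreover have "composition_operator (B \<circ> \<psi> \<circ> B) = composition_operator \<phi>"
      by (rule composition_operator_cong) (use B1 in \<open>simp add: \<psi>c \<phi>_eq\<close>)
    moreover have "times_space (S \<circ> B \<circ> B) (hardy_space p) = times_space S (hardy_space p)" for S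
      by (rule times_space_cong) (simp add: BB)
    ultimately show "?incl \<phi> S\<^sub>1 S\<^sub>2" by (simp only:)
  qed

  have sufficient: "?incl \<psi> (S\<^sub>1 \<circ> B) (S\<^sub>2 \<circ> B)"
    if le: "\<And>E. E \<in> sets circle_borel \<Longrightarrow> emeasure \<nu>\<^sub>2 E \<le> emeasure \<sigma> E"
  proof (rule composition_inclusion_if_measure_le[OF p \<psi>_hol \<psi>_map _ _ \<sigma> \<nu>(2) _ _ le])
    have SB: "(S\<^sub>1 \<circ> B) holomorphic_on unit_disk" "(S\<^sub>2 \<circ> B) holomorphic_on unit_disk"
      using B_map by (auto intro!: holomorphic_on_compose_gen[OF B_hol] S_hol)
    then show "(S\<^sub>2 \<circ> B) holomorphic_on unit_disk" by blast
    have "(S\<^sub>1 \<circ> B) \<circ> \<psi> holomorphic_on unit_disk"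
      using \<psi>_map by (intro holomorphic_on_compose_gen[OF \<psi>_hol SB(1)]) auto
    then show "(\<lambda>z. (S\<^sub>1 \<circ> B) (\<psi> z)) holomorphic_on unit_disk" by (simp add: o_def)
    fix z :: complex assume z: "cmod z < 1"
    show "cmod ((S\<^sub>1 \<circ> B) (\<psi> z)) = exp (- poisson_integral \<sigma> z)"
      using z by (simp add: \<psi>c nS1 B1 c1 P\<sigma>)
    show "cmod ((S\<^sub>2 \<circ> B) z) = exp (- poisson_integral \<nu>\<^sub>2 z)"
      using z by (simp add: nS2 B1 P\<nu>)
  qed

  have necessary: "emeasure \<nu>\<^sub>2 E \<le> emeasure \<sigma> E" if incl: "?incl \<phi> S\<^sub>1 S\<^sub>2" and E: "E \<in> sets circle_borel" for E
  proof -
    have "composition_operator \<phi> (\<lambda>z\<in>unit_disk. S\<^sub>1 z * (\<lambda>z\<in>unit_disk. 1) z) \<in> times_space S\<^sub>2 (hardy_space p)"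
      using incl one_in_hardy_space unfolding times_space_def by blast
    then obtain g where g: "g \<in> hardy_space p"
      and eq: "composition_operator \<phi> (\<lambda>z\<in>unit_disk. S\<^sub>1 z * (\<lambda>z\<in>unit_disk. 1) z) = (\<lambda>z\<in>unit_disk. S\<^sub>2 z * g z)"
      unfolding times_space_def by blast
    \<comment> \<open>The measure of \<open>S\<^sub>1 \<circ> \<phi>\<close>, because \<open>\<phi> = B \<circ> (\<lambda>z. c * z) \<circ> B\<close>.\<close>
    define \<tau> where "\<tau> = transported_measure \<omega> \<sigma>"
    have \<tau>: "circle_measure \<tau>" unfolding \<tau>_def by (rule circle_measure_transported_measure[OF \<omega> \<sigma>])
    have gnorm: "cmod (g z) = exp (poisson_integral \<mu>\<^sub>2 z - poisson_integral \<tau> z)" if z: "cmod z < 1" for z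
    proof -
      have \<phi>z: "cmod (\<phi> z) < 1" using \<phi>_map z by auto
      have "S\<^sub>1 (\<phi> z) = S\<^sub>2 z * g z"
        using fun_cong[OF eq, of z] z \<phi>z by (simp add: composition_operator_def compose_def)
      then have "exp (- poisson_integral \<mu>\<^sub>1 (\<phi> z)) = exp (- poisson_integral \<mu>\<^sub>2 z) * cmod (g z)"
        using nS1[OF \<phi>z] nS2[OF z] by (metis norm_mult)
      moreover have "poisson_integral \<mu>\<^sub>1 (\<phi> z) = poisson_integral \<tau> z"
        using poisson_integral_transported_measure[OF \<omega> \<sigma> z] P\<sigma>[OF B1[OF z]]
        by (simp add: \<tau>_def \<phi>_eq[OF z] B_def)
      ultimately show ?thesis by (simp add: exp_diff exp_minus field_simps)
    qed
    have "emeasure \<mu>\<^sub>2 F \<le> emeasure \<tau> F" if "F \<in> sets circle_borel" for F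
      by (rule singular_measure_le[OF p g assms(8) \<tau> gnorm that])
    from transported_measure_mono[OF \<omega> \<mu>(2) \<tau> this E] show ?thesis
      by (simp add: assms(12) \<tau>_def transported_measure_involution[OF \<omega> \<sigma>])
  qed

  have image: "emeasure \<nu>\<^sub>1 (B ` (boundary_map \<phi> ` E)) = emeasure \<sigma> (B ` E)"
    and B_sets: "B ` E \<in> sets circle_borel" if E: "E \<in> sets circle_borel" for E
  proof -
    have sub: "E \<subseteq> unit_circle" by (rule sets_circle_borel_subset[OF E])
    show Bs: "B ` E \<in> sets circle_borel"
      using measurable_sets[OF blaschke_measurable[OF \<omega>] E] blaschke_image_circle[OF \<omega> sub] by (simp add: B_def)
    have Bc: "cmod (B t) = 1" if "cmod t = 1" for t using blaschke_circle[OF \<omega> that] by (simp add: B_def)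
    have Ble: "cmod (B z) \<le> 1" if "cmod z \<le> 1" for z
      using B1[of z] Bc[of z] that by linarith
    have Bcont: "continuous_on (cball 0 1) B" unfolding B_def by (rule continuous_on_blaschke[OF \<omega>])
    have "continuous_on (cball 0 1) (\<lambda>z. B (c * B z))"
      by (rule continuous_on_compose2[OF Bcont]) (auto intro!: continuous_intros Bcont simp: c1 Ble)
    then have "boundary_map \<phi> t = B (c * B t)" if "cmod t = 1" for t
      using boundary_map_eq[of "\<lambda>z. B (c * B z)" \<phi> t] \<phi>_eq that by blast
    then have "B (boundary_map \<phi> t) = c * B t" if "t \<in> E" for t
      using that sub by (auto simp: BB c1 Bc)
    then have "B ` (boundary_map \<phi> ` E) = (\<lambda>t. c * t) ` (B ` E)"
      unfolding image_image by (intro image_cong refl)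
    then show "emeasure \<nu>\<^sub>1 (B ` (boundary_map \<phi> ` E)) = emeasure \<sigma> (B ` E)"
      unfolding \<sigma>_def by (simp add: emeasure_rotated_measure[OF c \<nu>(1) Bs])
  qed
  have "(\<forall>E \<in> sets circle_borel. emeasure \<nu>\<^sub>2 (B ` E) \<le> emeasure \<nu>\<^sub>1 (B ` (boundary_map \<phi> ` E)))
      \<longleftrightarrow> (\<forall>E \<in> sets circle_borel. emeasure \<nu>\<^sub>2 E \<le> emeasure \<sigma> E)"
  proof
    assume *: "\<forall>E \<in> sets circle_borel. emeasure \<nu>\<^sub>2 (B ` E) \<le> emeasure \<nu>\<^sub>1 (B ` (boundary_map \<phi> ` E))"
    show "\<forall>E \<in> sets circle_borel. emeasure \<nu>\<^sub>2 E \<le> emeasure \<sigma> E"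
    proof
      fix E assume E: "E \<in> sets circle_borel"
      have "B (B t) = t" if "t \<in> E" for t
        using that sets_circle_borel_subset[OF E] by (auto simp: BB)
      then have "B ` (B ` E) = E" by (simp add: image_image)
      then show "emeasure \<nu>\<^sub>2 E \<le> emeasure \<sigma> E"
        using bspec[OF *, of "B ` E"] image[of "B ` E"] B_sets[OF E] by simp
    qed
  qed (use image B_sets in simp)
  then show ?thesis
    using conj sufficient necessary unfolding B_def by blast
qed

end
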